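(* Let $f:\mathbb{R}^d\to\mathbb{R}$ be continuous, let $\Lambda_1,\dots,\Lambda_d$ be compact subsets of $\mathbb{R}$, $\Lambda=\Lambda_1\times\cdots\times\Lambda_d$, and let $\boldsymbol{\nu}=(\nu_1,\dots,\nu_d)$ with $\nu_i\in\mathcal{P}(\mathbb{R})$ satisfy: there is a constant $\theta>0$ with $\sup_{1\le i\le d}\int e^{\theta x^2}\nu_i(dx)<\infty$, and $\int x\,\nu_i(dx)=0$ for all $1\le i\le d$. Suppose that $\boldsymbol{\mathcal{M}}^{\Lambda}_{\boldsymbol{\nu}}(\varepsilon)\ne\varnothing$ for some $\varepsilon>0$. Set $$\boldsymbol{I}^\Lambda_{\boldsymbol{\nu}}(\varepsilon)=\sup_{\pi\in\boldsymbol{\mathcal{M}}^{\Lambda}_{\boldsymbol{\nu}}(\varepsilon)}\mathbb{E}_\pi[f(\mathbf{X})],\qquad \boldsymbol{J}^\Lambda_{\boldsymbol{\nu}}(\varepsilon)=\inf\Big\{\gamma\varepsilon+\sum_{k=1}^d\int_{\mathbb{R}}\beta_k(x_k)\,\nu_k(dx_k)\Big\},$$ where the infimum is over all $\gamma\in\mathbb{R}_{\ge0}$, $\eta\in\mathbb{R}$, $\boldsymbol{\alpha}=(\alpha_1,\dots,\alpha_{d-1})$ with $\alpha_k\in C(\Lambda_1\times\cdots\times\Lambda_k)$ for $1\le k\le d-1$, and $\boldsymbol{\beta}=(\beta_1,\dots,\beta_d)$ with $\beta_k\in C_b(\mathbb{R})$ for $1\le k\le d$, such that for all $\mathbf{x}\in\mathbb{R}^d$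 and $\mathbf{x}'\in\Lambda$, $$f(\mathbf{x}')+\sum_{k=1}^{d-1}\alpha_k(x_1',\dots,x_k')(x_{k+1}'-x_k')-\gamma\|\mathbf{x}-\mathbf{x}'\|_1-\sum_{k=1}^d\beta_k(x_k)+\eta x_1'\le0.$$ Then strong duality $\boldsymbol{I}^\Lambda_{\boldsymbol{\nu}}(\varepsilon)=\boldsymbol{J}^\Lambda_{\boldsymbol{\nu}}(\varepsilon)$ holds, and there exists a primal optimizer $\pi^{\mathrm{DRO}}\in\boldsymbol{\mathcal{M}}^{\Lambda}_{\boldsymbol{\nu}}(\varepsilon)$, i.e. $\mathbb{E}_{\pi^{\mathrm{DRO}}}[f(\mathbf{X})]=\boldsymbol{I}^\Lambda_{\boldsymbol{\nu}}(\varepsilon)$.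
   Context: $\mathcal{P}(S)$ is the set of Borel probability measures on $S$; $C(S)$ (resp. $C_b(S)$) is the set of real continuous (resp. bounded continuous) functions on $S$. $\mathbf{X}=(X_1,\dots,X_d)$ is the canonical (identity) map on $\mathbb{R}^d$, $\mathbb{E}_\pi$ is expectation when $\mathbf{X}\sim\pi$. $\mathcal{M}_0(\mathbb{R}^d)$ is the set of martingale measures $\pi$ on $\mathbb{R}^d$ (i.e. $\mathbb{E}_\pi[X_{k+1}\mid\sigma(X_1,\dots,X_k)]=X_k$ $\pi$-a.e. for $1\le k\le d-1$) centered at zero, i.e. all of whose marginals have expectation zero. $\Pi(\boldsymbol{\nu})$ is the set of probability measures on $\mathbb{R}^d$ with $i$-th marginal $\nu_i$ for all $i$. $\mathcal{W}$ is the Wasserstein distance with cost $\|\mathbf{x}-\mathbf{y}\|_1=\sum_i|x_i-y_i|$, and $d(\pi,\Pi(\boldsymbol{\nu}))=\inf\{\mathcal{W}(\pi,\pi'):\pi'\in\Pi(\boldsymbol{\nu})\}$. $\boldsymbol{\mathcal{M}}_{\boldsymbol{\nu}}(\varepsilon)=\{\pi\in\mathcal{M}_0(\mathbb{R}^d):d(\pi,\Pi(\boldsymbol{\nu}))\le\varepsilon\}$ and $\boldsymbol{\mathcal{M}}^{\Lambda}_{\boldsymbol{\nu}}(\varepsilon)=\boldsymbol{\mathcal{M}}_{\boldsymbol{\nu}}(\varepsilon)\cap\mathcal{P}(\Lambda)$. *)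

theory Defs
  imports "HOL-Probability.Probability"
begin

text \<open>
  Points of $d$-dimensional space are functions on the index set \<open>{1..d}\<close> (extended by
  \<open>undefined\<close> elsewhere), so that initial segments $(x_1,\dots,x_k)$ are restrictions to \<open>{1..k}\<close>.
  Topological notions on sets of such points refer to the product topology on
  \<^typ>\<open>nat \<Rightarrow> real\<close>; on \<open>PiE {1..d} (\<lambda>_. UNIV)\<close> it induces the Euclidean topology, and the
  product sigma-algebra below is the Borel sigma-algebra.
\<close>

definition Rn :: "nat \<Rightarrow> (nat \<Rightarrow> real) measure" where
  "Rn d = PiM {1..d} (\<lambda>_. borel)"

definition prob_Rn :: "nat \<Rightarrow> (nat \<Rightarrow> real) measure set" where
  "prob_Rn d = {\<pi>. prob_space \<pi> \<and> sets \<pi> = sets (Rn d)}"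

definition prob_on :: "nat \<Rightarrow> (nat \<Rightarrow> real) set \<Rightarrow> (nat \<Rightarrow> real) measure set" where
  "prob_on d S = {\<pi> \<in> prob_Rn d. S \<in> sets (Rn d) \<and> emeasure \<pi> S = 1}"

definition marginal :: "(nat \<Rightarrow> real) measure \<Rightarrow> nat \<Rightarrow> real measure" where
  "marginal \<pi> i = distr \<pi> borel (\<lambda>x. x i)"

text \<open>The sigma-algebra $\sigma(X_1,\dots,X_k)$ of the canonical process.\<close>

definition coord_algebra :: "(nat \<Rightarrow> real) measure \<Rightarrow> nat \<Rightarrow> (nat \<Rightarrow> real) measure" where
  "coord_algebra \<pi> k = vimage_algebra (space \<pi>) (\<lambda>x. restrict x {1..k}) (Rn k)"

definition martingale_measure :: "nat \<Rightarrow> (nat \<Rightarrow> real) measure \<Rightarrow> bool" where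
  "martingale_measure d \<pi> \<longleftrightarrow>
     \<pi> \<in> prob_Rn d \<and>
     (\<forall>k\<in>{1..d}. integrable \<pi> (\<lambda>x. x k)) \<and>
     (\<forall>k\<in>{1..<d}. AE x in \<pi>. real_cond_exp \<pi> (coord_algebra \<pi> k) (\<lambda>x. x (Suc k)) x = x k)"

definition centered_martingale_measures :: "nat \<Rightarrow> (nat \<Rightarrow> real) measure set" where
  "centered_martingale_measures d =
     {\<pi>. martingale_measure d \<pi> \<and> (\<forall>i\<in>{1..d}. (\<integral>x. x \<partial>marginal \<pi> i) = 0)}"

definition with_marginals :: "nat \<Rightarrow> (nat \<Rightarrow> real measure) \<Rightarrow> (nat \<Rightarrow> real) measure set" where
  "with_marginals d \<nu> = {\<pi> \<in> prob_Rn d. \<forall>i\<in>{1..d}. marginal \<pi> i = \<nu> i}"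

definition l1_dist :: "nat \<Rightarrow> (nat \<Rightarrow> real) \<Rightarrow> (nat \<Rightarrow> real) \<Rightarrow> real" where
  "l1_dist d x y = (\<Sum>i\<in>{1..d}. \<bar>x i - y i\<bar>)"

definition couplings ::
    "nat \<Rightarrow> (nat \<Rightarrow> real) measure \<Rightarrow> (nat \<Rightarrow> real) measure \<Rightarrow> ((nat \<Rightarrow> real) \<times> (nat \<Rightarrow> real)) measure set" where
  "couplings d \<pi> \<pi>' =
     {\<mu>. prob_space \<mu> \<and> sets \<mu> = sets (Rn d \<Otimes>\<^sub>M Rn d) \<and>
         distr \<mu> (Rn d) fst = \<pi> \<and> distr \<mu> (Rn d) snd = \<pi>'}"

definition wasserstein :: "nat \<Rightarrow> (nat \<Rightarrow> real) measure \<Rightarrow> (nat \<Rightarrow> real) measure \<Rightarrow> ennreal" where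
  "wasserstein d \<pi> \<pi>' =
     (INF \<mu>\<in>couplings d \<pi> \<pi>'. \<integral>\<^sup>+(x, y). ennreal (l1_dist d x y) \<partial>\<mu>)"

definition marginal_dist :: "nat \<Rightarrow> (nat \<Rightarrow> real measure) \<Rightarrow> (nat \<Rightarrow> real) measure \<Rightarrow> ennreal" where
  "marginal_dist d \<nu> \<pi> = (INF \<pi>'\<in>with_marginals d \<nu>. wasserstein d \<pi> \<pi>')"

definition mart_ball :: "nat \<Rightarrow> (nat \<Rightarrow> real measure) \<Rightarrow> real \<Rightarrow> (nat \<Rightarrow> real) measure set" where
  "mart_ball d \<nu> \<epsilon> =
     {\<pi> \<in> centered_martingale_measures d. marginal_dist d \<nu> \<pi> \<le> ennreal \<epsilon>}"

definition mart_ball_on ::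
    "nat \<Rightarrow> (nat \<Rightarrow> real set) \<Rightarrow> (nat \<Rightarrow> real measure) \<Rightarrow> real \<Rightarrow> (nat \<Rightarrow> real) measure set" where
  "mart_ball_on d \<Lambda> \<nu> \<epsilon> = mart_ball d \<nu> \<epsilon> \<inter> prob_on d (PiE {1..d} \<Lambda>)"

text \<open>
  Both optimal values are taken in the extended reals, so that they are the true supremum and
  infimum without any boundedness or nonemptiness requirement.
\<close>

definition primal_value ::
    "nat \<Rightarrow> ((nat \<Rightarrow> real) \<Rightarrow> real) \<Rightarrow> (nat \<Rightarrow> real set) \<Rightarrow> (nat \<Rightarrow> real measure) \<Rightarrow> real \<Rightarrow> ereal" where
  "primal_value d f \<Lambda> \<nu> \<epsilon> = (SUP \<pi>\<in>mart_ball_on d \<Lambda> \<nu> \<epsilon>. ereal (\<integral>x. f x \<partial>\<pi>))"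

definition dual_feasible ::
    "nat \<Rightarrow> ((nat \<Rightarrow> real) \<Rightarrow> real) \<Rightarrow> (nat \<Rightarrow> real set) \<Rightarrow>
     (real \<times> real \<times> (nat \<Rightarrow> (nat \<Rightarrow> real) \<Rightarrow> real) \<times> (nat \<Rightarrow> real \<Rightarrow> real)) set" where
  "dual_feasible d f \<Lambda> =
     {(\<gamma>, \<eta>, \<alpha>, \<beta>).
        \<gamma> \<ge> 0 \<and>
        (\<forall>k\<in>{1..d - 1}. continuous_on (PiE {1..k} \<Lambda>) (\<alpha> k)) \<and>
        (\<forall>k\<in>{1..d}. continuous_on UNIV (\<beta> k) \<and> bounded (range (\<beta> k))) \<and>
        (\<forall>x \<in> PiE {1..d} (\<lambda>_. UNIV). \<forall>x' \<in> PiE {1..d} \<Lambda>.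
           f x' + (\<Sum>k\<in>{1..d - 1}. \<alpha> k (restrict x' {1..k}) * (x' (Suc k) - x' k))
             - \<gamma> * l1_dist d x x' - (\<Sum>k\<in>{1..d}. \<beta> k (x k)) + \<eta> * x' 1 \<le> 0)}"

definition dual_value ::
    "nat \<Rightarrow> ((nat \<Rightarrow> real) \<Rightarrow> real) \<Rightarrow> (nat \<Rightarrow> real set) \<Rightarrow> (nat \<Rightarrow> real measure) \<Rightarrow> real \<Rightarrow> ereal" where
  "dual_value d f \<Lambda> \<nu> \<epsilon> =
     (INF (\<gamma>, \<eta>, \<alpha>, \<beta>)\<in>dual_feasible d f \<Lambda>.
        ereal (\<gamma> * \<epsilon> + (\<Sum>k\<in>{1..d}. \<integral>x. \<beta> k x \<partial>\<nu> k)))"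

end

theory Submission
  imports Defs
begin

text \<open>
  The easy inequality is obtained by integrating the dual constraint against a coupling of \<open>\<pi>\<close>
  with a measure that has the prescribed marginals: the terms with \<open>\<alpha>\<close> and \<open>\<eta>\<close> vanish because \<open>\<pi>\<close>
  is a centered martingale measure, the \<open>\<beta>\<close> terms see only the marginals, and the cost is at most
  \<open>\<epsilon>\<close> up to an arbitrarily small error (\<open>weak_duality\<close>).

  For the other inequality, let \<open>v\<close> be the dual value. A measure in the ball with objective at least
  \<open>v\<close> is sought as a marginal of a joint law of \<open>(x', x)\<close>, where \<open>x'\<close> lives in \<open>\<Lambda>\<close>
  and \<open>x\<close> has the marginals \<open>\<nu>\<close>. Looking for the coupling itself, and not for its first
  marginal alone, avoids any gluing of couplings and any duality theorem for transport costs.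
  The coordinates of \<open>x\<close> are compactified by \<open>arctan\<close>, so that the joint law lives on a
  compact set of points \<open>\<omega>\<close>, and all requirements on it are written as countably many inequalities
  \<open>\<integral> h \<ge> 0\<close> with continuous \<open>h\<close>:

    \<^item> for the objective, \<open>f(x') - v\<close>;

    \<^item> for the mean, \<open>x' 1\<close> and its negative;

    \<^item> for the martingale property, the increments of \<open>x'\<close> multiplied by products of
      piecewise linear ramps in the past coordinates, with both signs;

    \<^item> for the marginals, ramps of \<open>arctan (x k)\<close> minus their \<open>\<nu> k\<close>-mean, with both signs;

    \<^item> for the cost, \<open>\<epsilon>\<close> minus the distance from \<open>x'\<close> to \<open>x\<close> clipped to a large cube.
      Clipping makes the cost continuous on the compactification and can only decrease it, because
      \<open>x'\<close> lies in the cube.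

  Each of these functions dominates a Lagrangian plus the corresponding cost of the multipliers, and
  the functions with this property form a convex cone (\<open>dominating\<close>). If a nonnegative
  combination were at most \<open>-\<delta> < 0\<close> on the whole compact set, its multipliers would either, after
  normalisation, be dual feasible with a value below \<open>v\<close>, or, if the objective does not enter, contradict weak
  duality for the zero objective and the nonempty ball (\<open>dominating_not_negative\<close>). A theorem of the
  alternative (\<open>countable_moment_alternative\<close>) then yields the joint law: for finitely many
  functions an approximate minimiser of the sum of squared violations does the job, and a weak limit
  handles countably many. Its first marginal belongs to the ball (\<open>primal_measure_of_moments\<close>), and
  weak duality turns the lower bound \<open>v\<close> into equality and optimality.

  Compactness of the measures on a compact set of sequences is reduced to Helly's selection theorem
  on the line, since such a set is a continuous image of a compact set of reals
  (\<open>compact_sequences_image_of_compact_real\<close>).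
\<close>

section \<open>Finitely many inequalities\<close>

lemma expectation_mix_dirac:
  fixes g :: "'a \<Rightarrow> real"
  assumes "finite (set_pmf p)" "0 \<le> t" "t \<le> 1"
  shows "measure_pmf.expectation (bernoulli_pmf t \<bind> (\<lambda>b. if b then return_pmf \<omega> else p)) g
    = (1 - t) * measure_pmf.expectation p g + t * g \<omega>"
  using assms by (subst pmf_expectation_bind[where A = UNIV]) (auto simp: UNIV_bool)

text \<open>
  If the infimum \<open>m\<close> of the sum of squared violations were positive, moving mass towards the point
  mass at \<open>x\<close> could not improve an almost optimal \<open>p\<close> noticeably. This first order condition says that the
  violations \<open>c i\<close> of \<open>p\<close>, used as weights, satisfy \<open>\<Sum>i<n. c i * h i x \<le> - m / 2\<close> for
  every \<open>x\<close>, which the hypothesis excludes. An approximate minimiser suffices, so no compactness is involved yet.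
\<close>

lemma finitely_supported_alternative:
  fixes h :: "nat \<Rightarrow> 'a \<Rightarrow> real"
  assumes bdd: "\<And>i x. i < n \<Longrightarrow> x \<in> K \<Longrightarrow> \<bar>h i x\<bar> \<le> B"
    and alt: "\<And>c \<delta>. (\<And>i. c i \<ge> 0) \<Longrightarrow> \<delta> > 0 \<Longrightarrow> \<exists>x\<in>K. (\<Sum>i<n. c i * h i x) > - \<delta>"
    and "\<delta> > 0"
  shows "\<exists>p. finite (set_pmf p) \<and> set_pmf p \<subseteq> K \<and> (\<forall>i<n. measure_pmf.expectation p (h i) \<ge> - \<delta>)"
proof -
  define E where "E p i = measure_pmf.expectation p (h i)" for p i
  define \<Phi> where "\<Phi> p = (\<Sum>i<n. (max 0 (- E p i))\<^sup>2)" for p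
  define S where "S = {p. finite (set_pmf p) \<and> set_pmf p \<subseteq> K}"
  obtain x0 where x0: "x0 \<in> K" using alt[of "\<lambda>_. 0" 1] by auto
  have S_ne: "S \<noteq> {}" using x0 by (auto simp: S_def intro!: exI[of _ "return_pmf x0"])
  have \<Phi>_nn: "\<Phi> p \<ge> 0" for p by (auto simp: \<Phi>_def intro: sum_nonneg)
  have bb: "bdd_below (\<Phi> ` S)" using \<Phi>_nn by (auto intro!: bdd_belowI[of _ 0])
  define m where "m = (INF p\<in>S. \<Phi> p)"
  have m_le: "m \<le> \<Phi> p" if "p \<in> S" for p unfolding m_def using bb that by (rule cINF_lower)
  have m_approx: "\<exists>p\<in>S. \<Phi> p < m + e" if "e > 0" for e
    using cINF_less_iff[OF S_ne bb, of "m + e"] that by (auto simp: m_def)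
  have E_bd: "\<bar>E p i\<bar> \<le> B" if "p \<in> S" "i < n" for p i
  proof -
    have "AE x in measure_pmf p. norm (h i x) \<le> B"
      using that bdd by (auto simp: AE_measure_pmf_iff S_def)
    moreover have "integrable (measure_pmf p) (h i)"
      using that by (auto simp: S_def intro!: integrable_measure_pmf_finite)
    ultimately have "norm (E p i) \<le> B"
      unfolding E_def using measure_pmf.integral_le_const[of p "h i" B]
        measure_pmf.integral_ge_const[of p "h i" "- B"]
      by (auto simp: AE_measure_pmf_iff abs_le_iff minus_le_iff)
    then show ?thesis by simp
  qed
  have "m \<le> 0"
  proof (rule ccontr)
    assume "\<not> m \<le> 0"
    then have m: "m > 0" by simp
    have n: "n > 0" by (rule ccontr) (use m m_le S_ne in \<open>auto simp: \<Phi>_def\<close>)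
    have B0: "B \<ge> 0" using bdd[OF n x0] by linarith
    define C where "C = 4 * B\<^sup>2 * n"
    have C0: "C \<ge> 0" by (simp add: C_def)
    \<comment> \<open>The step length is chosen so that the quadratic error of the perturbation stays below half of the gain.\<close>
    define t where "t = min 1 (m / (2 * (C + 1)))"
    have t: "0 < t" "t \<le> 1" and tC: "t * C \<le> m / 2"
    proof -
      show "0 < t" "t \<le> 1" using m C0 by (auto simp: t_def)
      have "t * C \<le> t * (C + 1)" using \<open>0 < t\<close> by simp
      also have "\<dots> \<le> (m / (2 * (C + 1))) * (C + 1)"
        using C0 by (intro mult_right_mono) (auto simp: t_def)
      also have "\<dots> = m / 2"
      proof -
        have "(m / (2 * D)) * D = m / 2" if "D \<noteq> 0" for D :: real using that by simp
        then show ?thesis using C0 by (simp add: add_nonneg_eq_0_iff del: distrib_left_numeral)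
      qed
      finally show "t * C \<le> m / 2" .
    qed
    obtain p where p: "p \<in> S" "\<Phi> p < m + t * m / 2" using m_approx[of "t * m / 2"] m t by auto
    have gain: "s \<le> - (m / 2)" if "m \<le> P - 2 * t * (s + P) + t\<^sup>2 * C" "P < m + t * m / 2" "m \<le> P" for s P
    proof -
      have "t * (t * C) \<le> t * (m / 2)" using tC t by (intro mult_left_mono) auto
      moreover have "t\<^sup>2 * C = t * (t * C)" by (simp add: power2_eq_square)
      ultimately have "2 * t * (s + P) \<le> t * m / 2 + t * (m / 2)" using that by linarith
      also have "\<dots> = t * m" by simp
      finally have "t * (2 * s + 2 * P) \<le> t * m" by (simp add: algebra_simps)
      then have "2 * s + 2 * P \<le> m" using t(1) by (simp only: mult_le_cancel_left_pos)
      then show ?thesis using that by linarith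
    qed
    define c where "c i = max 0 (- E p i)" for i
    have "(\<Sum>i<n. c i * h i x) \<le> - (m / 2)" if x: "x \<in> K" for x
    proof -
      define q where "q = (bernoulli_pmf t \<bind> (\<lambda>b. if b then return_pmf x else p))"
      have qS: "q \<in> S" using p x by (auto simp: q_def S_def set_bind_pmf split: if_splits)
      define dd where "dd i = h i x - E p i" for i
      have Eq: "E q i = E p i + t * dd i" for i
        unfolding E_def q_def dd_def
        using expectation_mix_dirac[of p t x "h i"] p t by (simp add: S_def algebra_simps)
      have dB: "(dd i)\<^sup>2 \<le> 4 * B\<^sup>2" if "i < n" for i
      proof -
        have "\<bar>dd i\<bar> \<le> 2 * B" using E_bd[OF p(1) that] bdd[OF that x] by (auto simp: dd_def)
        then have "\<bar>dd i\<bar>\<^sup>2 \<le> (2 * B)\<^sup>2" by (intro power_mono) auto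
        then show ?thesis by (simp add: power_mult_distrib)
      qed
      have "m \<le> \<Phi> q" by (rule m_le[OF qS])
      also have "\<dots> \<le> (\<Sum>i<n. (c i - t * dd i)\<^sup>2)"
        unfolding \<Phi>_def
      proof (rule sum_mono)
        fix i
        show "(max 0 (- E q i))\<^sup>2 \<le> (c i - t * dd i)\<^sup>2"
        proof (cases "E q i \<ge> 0")
          case False
          then show ?thesis unfolding c_def Eq by (intro power_mono) auto
        qed auto
      qed
      finally have "m \<le> (\<Sum>i<n. (c i - t * dd i)\<^sup>2)" .
      moreover have "(\<Sum>i<n. (c i - t * dd i)\<^sup>2)
          = (\<Sum>i<n. (c i)\<^sup>2) - 2 * t * (\<Sum>i<n. c i * dd i) + t\<^sup>2 * (\<Sum>i<n. (dd i)\<^sup>2)"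
        by (simp add: power2_diff power_mult_distrib sum.distrib sum_subtractf sum_distrib_left mult.assoc
            mult.left_commute)
      moreover have "(\<Sum>i<n. c i * dd i) = (\<Sum>i<n. c i * h i x) + \<Phi> p"
      proof -
        have "c i * dd i = c i * h i x + (max 0 (- E p i))\<^sup>2" for i
          by (cases "E p i \<ge> 0") (auto simp: c_def dd_def power2_eq_square algebra_simps)
        then show ?thesis by (simp add: \<Phi>_def sum.distrib)
      qed
      moreover have "(\<Sum>i<n. (c i)\<^sup>2) = \<Phi> p" by (simp add: \<Phi>_def c_def)
      ultimately have "m \<le> \<Phi> p - 2 * t * ((\<Sum>i<n. c i * h i x) + \<Phi> p) + t\<^sup>2 * (\<Sum>i<n. (dd i)\<^sup>2)" by metis
      moreover have "t\<^sup>2 * (\<Sum>i<n. (dd i)\<^sup>2) \<le> t\<^sup>2 * C"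
        using sum_mono[of "{..<n}" "\<lambda>i. (dd i)\<^sup>2" "\<lambda>_. 4 * B\<^sup>2"] dB
        by (intro mult_left_mono) (auto simp: C_def algebra_simps)
      ultimately have "m \<le> \<Phi> p - 2 * t * ((\<Sum>i<n. c i * h i x) + \<Phi> p) + t\<^sup>2 * C" by linarith
      then show ?thesis by (rule gain) (use p m_le in auto)
    qed
    moreover obtain x where "x \<in> K" "(\<Sum>i<n. c i * h i x) > - (m / 2)"
      using alt[of c "m / 2"] m by (auto simp: c_def)
    ultimately show False by (meson not_less)
  qed
  have "\<delta>\<^sup>2 > 0" using \<open>\<delta> > 0\<close> by simp
  then obtain p where p: "p \<in> S" "\<Phi> p < m + \<delta>\<^sup>2" using m_approx by blast
  have "E p i \<ge> - \<delta>" if "i < n" for i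
  proof -
    have "(max 0 (- E p i))\<^sup>2 \<le> \<Phi> p"
      unfolding \<Phi>_def using that member_le_sum[of i "{..<n}" "\<lambda>i. (max 0 (- E p i))\<^sup>2"] by simp
    then have "(max 0 (- E p i))\<^sup>2 \<le> \<delta>\<^sup>2" using p \<open>m \<le> 0\<close> by linarith
    then have "max 0 (- E p i) \<le> \<delta>" by (rule power2_le_imp_le) (use \<open>\<delta> > 0\<close> in simp)
    then show ?thesis by simp
  qed
  then show ?thesis using p by (auto simp: S_def E_def)
qed

section \<open>Compact sets of sequences as images of compact sets of reals\<close>

text \<open>
  Filling up with the singletons \<open>{undefined}\<close> turns an extensional product over \<open>I\<close> into one over
  all indices, where Tychonoff's theorem for the topology of pointwise convergence applies.
\<close>

lemma compact_PiE:
  fixes S :: "'i \<Rightarrow> 'b::topological_space set"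
  assumes "\<And>i. i \<in> I \<Longrightarrow> compact (S i)"
  shows "compact (PiE I S)"
proof -
  define S' where "S' i = (if i \<in> I then S i else {undefined})" for i
  have "PiE I S = PiE UNIV S'"
    by (auto simp: S'_def PiE_iff extensional_def split: if_splits)
  moreover have "compactin (product_topology (\<lambda>_. euclidean) UNIV) (PiE UNIV S')"
    unfolding compactin_PiE using assms by (auto simp: S'_def)
  ultimately show ?thesis by (simp add: euclidean_product_topology)
qed

text \<open>
  The Cantor space, realised inside the real sequences so that bit series are plain sums.
\<close>

definition bits :: "(nat \<Rightarrow> real) set" where
  "bits = PiE UNIV (\<lambda>_. {0, 1})"

lemma compact_bits: "compact bits"
  unfolding bits_def by (intro compact_PiE) auto

lemma bits_bounds:
  assumes "b \<in> bits" shows "0 \<le> b j" "b j \<le> 1"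
proof -
  have "b j = 0 \<or> b j = 1" using assms by (auto simp: bits_def PiE_iff)
  then show "0 \<le> b j" "b j \<le> 1" by auto
qed

lemma summable_bit_series:
  assumes "b \<in> bits" "0 \<le> q" "q < 1" shows "summable (\<lambda>j. b j * q ^ j)"
  by (rule summable_comparison_test'[where g = "\<lambda>j. q ^ j" and N = 0])
    (use assms bits_bounds[OF assms(1)] in \<open>auto simp: abs_mult intro!: summable_geometric mult_left_le_one_le\<close>)

lemma continuous_bit_series:
  assumes "0 \<le> q" "q < 1"
  shows "continuous_on bits (\<lambda>b. \<Sum>j. b j * q ^ j :: real)"
proof (rule uniform_limit_theorem[where F = sequentially])
  show "uniform_limit bits (\<lambda>n b. \<Sum>j<n. b j * q ^ j) (\<lambda>b. \<Sum>j. b j * q ^ j) sequentially"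
    by (rule Weierstrass_m_test[where M = "\<lambda>j. q ^ j"])
      (use assms bits_bounds in \<open>auto simp: abs_mult intro!: summable_geometric mult_left_le_one_le\<close>)
  show "\<forall>\<^sub>F n in sequentially. continuous_on bits (\<lambda>b. \<Sum>j<n. b j * q ^ j)"
    by (intro always_eventually allI continuous_intros continuous_on_subset[OF continuous_on_product_coordinates])
      auto
qed auto

text \<open>
  The first bit in which two sequences differ contributes \<open>(1/3)^j\<close>, twice as much as all later
  bits can compensate.
\<close>

lemma inj_on_ternary_series: "inj_on (\<lambda>b. \<Sum>j. b j * (1/3) ^ j :: real) bits"
proof (rule inj_onI, rule ccontr)
  fix b b' assume b: "b \<in> bits" and b': "b' \<in> bits"
    and eq: "(\<Sum>j. b j * (1/3) ^ j) = (\<Sum>j. b' j * (1/3) ^ j)" and "b \<noteq> b'"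
  then obtain j0 where "b j0 \<noteq> b' j0" by auto
  define j where "j = (LEAST j. b j \<noteq> b' j)"
  have j: "b j \<noteq> b' j" unfolding j_def by (rule LeastI) fact
  have less: "b i = b' i" if "i < j" for i using not_less_Least[of i "\<lambda>j. b j \<noteq> b' j"] that by (auto simp: j_def)
  define c where "c i = (b i - b' i) * (1/3) ^ i" for i
  have sm: "summable (\<lambda>j. b j * (1/3) ^ j)" "summable (\<lambda>j. b' j * (1/3) ^ j)"
    using summable_bit_series b b' by auto
  have smc: "summable c" unfolding c_def left_diff_distrib by (intro summable_diff sm)
  have "suminf c = 0"
    unfolding c_def left_diff_distrib using eq suminf_diff[OF sm] by simp
  moreover have "suminf c = (\<Sum>i. c (i + Suc j)) + (\<Sum>i<Suc j. c i)"
    by (rule suminf_split_initial_segment[OF smc])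
  moreover have "(\<Sum>i<Suc j. c i) = c j" using less by (simp add: c_def)
  moreover have "\<bar>c j\<bar> = (1/3) ^ j"
  proof -
    have "\<bar>b j - b' j\<bar> = 1" 
    proof -
      have "b j = 0 \<or> b j = 1" "b' j = 0 \<or> b' j = 1" using b b' by (auto simp: bits_def PiE_iff)
      then show ?thesis using j by auto
    qed
    then show ?thesis by (simp add: c_def abs_mult)
  qed
  moreover have "\<bar>\<Sum>i. c (i + Suc j)\<bar> \<le> (1/3) ^ j / 2"
  proof -
    have s3: "(\<lambda>i. (1/3) ^ (i + Suc j) :: real) sums ((1/3) ^ j / 2)"
      using sums_mult[OF geometric_sums[of "1/3 :: real"], of "(1/3) ^ Suc j"]
      by (simp add: power_add mult_ac)
    have le: "norm (c (i + Suc j)) \<le> (1/3) ^ (i + Suc j)" for i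
      using bits_bounds[OF b, of "i + Suc j"] bits_bounds[OF b', of "i + Suc j"]
      unfolding c_def real_norm_def abs_mult by (intro mult_left_le_one_le[THEN order_trans]) auto
    have "norm (\<Sum>i. c (i + Suc j)) \<le> (\<Sum>i. (1/3) ^ (i + Suc j))"
      by (rule norm_suminf_le[OF le]) (use s3 in \<open>simp add: sums_iff\<close>)
    then show ?thesis using s3 by (simp add: sums_iff)
  qed
  moreover have "(1/3 :: real) ^ j > 0" by simp
  ultimately show False by linarith
qed

lemma binary_expansion:
  assumes "0 \<le> x" "x \<le> (1::real)"
  obtains b where "b \<in> bits" "(\<Sum>j. b j * (1/2) ^ j) = 2 * x"
proof (cases "x = 1")
  case True
  have "(\<lambda>_. 1) \<in> bits" by (auto simp: bits_def)
  moreover have "(\<Sum>j. 1 * (1/2::real) ^ j) = 2 * x" using True by (simp add: suminf_geometric)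
  ultimately show ?thesis by (rule that)
next
  case False
  define b where "b j = real_of_int (\<lfloor>2 ^ Suc j * x\<rfloor> - 2 * \<lfloor>2 ^ j * x\<rfloor>)" for j
  have "b j \<in> {0, 1}" for j
  proof -
    have "\<lfloor>2 * (2 ^ j * x)\<rfloor> = 2 * \<lfloor>2 ^ j * x\<rfloor> \<or> \<lfloor>2 * (2 ^ j * x)\<rfloor> = 2 * \<lfloor>2 ^ j * x\<rfloor> + 1" by linarith
    then show ?thesis by (auto simp: b_def mult.assoc)
  qed
  then have bb: "b \<in> bits" by (auto simp: bits_def)
  have f0: "\<lfloor>x\<rfloor> = 0" using False assms by linarith
  have ps: "(\<Sum>j<n. b j * (1/2) ^ j) = 2 * (of_int \<lfloor>2 ^ n * x\<rfloor> / 2 ^ n)" for n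
    by (induction n) (auto simp: f0 b_def field_simps)
  have "(\<lambda>n. of_int \<lfloor>2 ^ n * x\<rfloor> / 2 ^ n) \<longlonglongrightarrow> x"
  proof (rule real_tendsto_sandwich[where f = "\<lambda>n. x - (1/2) ^ n" and h = "\<lambda>_. x"])
    show "\<forall>\<^sub>F n in sequentially. x - (1/2) ^ n \<le> of_int \<lfloor>2 ^ n * x\<rfloor> / 2 ^ n"
    proof (intro always_eventually allI)
      fix n :: nat
      have "2 ^ n * x - 1 \<le> of_int \<lfloor>2 ^ n * x\<rfloor>" by linarith
      then have "(2 ^ n * x - 1) / 2 ^ n \<le> of_int \<lfloor>2 ^ n * x\<rfloor> / 2 ^ n" by (intro divide_right_mono) auto
      then show "x - (1/2) ^ n \<le> of_int \<lfloor>2 ^ n * x\<rfloor> / 2 ^ n" by (simp add: field_simps)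
    qed
    show "\<forall>\<^sub>F n in sequentially. of_int \<lfloor>2 ^ n * x\<rfloor> / 2 ^ n \<le> x"
    proof (intro always_eventually allI)
      fix n :: nat
      have "of_int \<lfloor>2 ^ n * x\<rfloor> \<le> 2 ^ n * x" by linarith
      then show "of_int \<lfloor>2 ^ n * x\<rfloor> / 2 ^ n \<le> x" by (simp add: field_simps)
    qed
    show "(\<lambda>n. x - (1/2) ^ n) \<longlonglongrightarrow> x"
      using tendsto_diff[OF tendsto_const[of x] LIMSEQ_power_zero[of "1/2 :: real"]] by simp
  qed auto
  then have "(\<lambda>j. b j * (1/2) ^ j) sums (2 * x)"
    unfolding sums_def ps by (intro tendsto_mult tendsto_const)
  then show ?thesis using that[OF bb] by (simp add: sums_iff)
qed

text \<open>
  A compact set lies in a product of intervals, and one bit sequence encodes all coordinates of a point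
  by binary expansions, distributed over the positions by the pairing function. The same bit sequence is encoded
  injectively as a single real by the ternary series; by compactness the inverse of that encoding is
  continuous.
\<close>

lemma compact_sequences_image_of_compact_real:
  fixes K :: "(nat \<Rightarrow> real) set"
  assumes "compact K"
  obtains T :: "real set" and \<phi> where "compact T" "continuous_on T \<phi>" "\<phi> ` T = K"
proof -
  have "\<exists>r. r > 0 \<and> (\<forall>x\<in>K. \<bar>x i\<bar> \<le> r)" for i
  proof -
    have "compact ((\<lambda>x. x i) ` K)"
      by (intro compact_continuous_image assms continuous_on_subset[OF continuous_on_product_coordinates]) auto
    then show ?thesis
      using compact_imp_bounded bounded_pos by (metis imageI real_norm_def)
  qed
  then obtain r where r: "\<And>i. r i > 0" "\<And>i x. x \<in> K \<Longrightarrow> \<bar>x i\<bar> \<le> r i" by metis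
  define \<tau> where "\<tau> b = (\<Sum>j. b j * (1/3) ^ j :: real)" for b
  define \<Phi> where "\<Phi> b i = r i * ((\<Sum>j. b (prod_encode (i, j)) * (1/2) ^ j) - 1)" for b i
  have \<Phi>: "continuous_on bits \<Phi>"
  proof (rule continuous_on_coordinatewise_then_product)
    fix i
    have c: "continuous_on bits (\<lambda>b. (\<lambda>j. b (prod_encode (i, j))))"
      by (intro continuous_on_coordinatewise_then_product continuous_on_subset[OF continuous_on_product_coordinates]) auto
    have "continuous_on bits (\<lambda>b. \<Sum>j. b (prod_encode (i, j)) * (1/2) ^ j :: real)"
      by (rule continuous_on_compose2[OF continuous_bit_series c]) (auto simp: bits_def PiE_iff)
    then show "continuous_on bits (\<lambda>b. \<Phi> b i)" unfolding \<Phi>_def by (intro continuous_intros)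
  qed
  have surj: "\<exists>b\<in>bits. \<Phi> b = x" if "x \<in> K" for x
  proof -
    have "\<exists>b. b \<in> bits \<and> (\<Sum>j. b j * (1/2) ^ j) = x i / r i + 1" for i
    proof -
      have "0 \<le> (x i / r i + 1) / 2" "(x i / r i + 1) / 2 \<le> 1"
        using r(1)[of i] r(2)[OF that, of i] by (auto simp: field_simps abs_le_iff)
      from binary_expansion[OF this] show ?thesis by (metis nonzero_mult_div_cancel_left times_divide_eq_right zero_neq_numeral)
    qed
    then obtain b where b: "\<And>i. b i \<in> bits" "\<And>i. (\<Sum>j. b i j * (1/2) ^ j) = x i / r i + 1" by metis
    define b' where "b' n = (case prod_decode n of (i, j) \<Rightarrow> b i j)" for n
    have "b' \<in> bits" using b(1) by (auto simp: bits_def b'_def PiE_iff split: prod.splits)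
    moreover have "\<Phi> b' = x"
      using r(1) by (auto simp: \<Phi>_def b'_def b(2) fun_eq_iff less_imp_neq[symmetric] order.strict_implies_not_eq)
    ultimately show ?thesis by auto
  qed
  define D where "D = {b\<in>bits. \<Phi> b \<in> K}"
  have "compact D"
  proof -
    have "closed K" by (rule compact_imp_closed) fact
    then have "closedin (top_of_set bits) (bits \<inter> \<Phi> -` K)"
      by (intro continuous_closedin_preimage \<Phi>)
    moreover have "bits \<inter> \<Phi> -` K = D" by (auto simp: D_def)
    ultimately show ?thesis using closedin_compact compact_bits by metis
  qed
  have \<tau>: "continuous_on D \<tau>" unfolding \<tau>_def
    by (rule continuous_on_subset[OF continuous_bit_series]) (auto simp: D_def)
  have inj: "inj_on \<tau> D" unfolding \<tau>_def
    by (rule inj_on_subset[OF inj_on_ternary_series]) (auto simp: D_def)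
  have inv: "continuous_on (\<tau> ` D) (inv_into D \<tau>)"
    by (rule continuous_on_inv[OF \<tau> \<open>compact D\<close>]) (simp add: inj)
  show ?thesis
  proof
    show "compact (\<tau> ` D)" by (intro compact_continuous_image \<tau> \<open>compact D\<close>)
    show "continuous_on (\<tau> ` D) (\<Phi> \<circ> inv_into D \<tau>)"
      by (rule continuous_on_compose[OF inv])
        (use inj in \<open>auto intro!: continuous_on_subset[OF \<Phi>] simp: D_def[symmetric]\<close>, auto simp: D_def)
    show "(\<Phi> \<circ> inv_into D \<tau>) ` \<tau> ` D = K"
      using surj inj by (force simp: D_def image_comp image_iff)
  qed
qed

section \<open>Countably many inequalities on a compact set\<close>

text \<open>
  A sequential form of Prokhorov's theorem. The measures are lifted along \<open>\<phi>\<close> to the compact set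
  \<open>T\<close> of reals, where they are tight; discrete measures make the lift trivial, since a section of
  \<open>\<phi>\<close> need not be measurable. Test functions composed with \<open>\<phi>\<close> are extended from \<open>T\<close> to
  the line by Tietze's theorem.
\<close>

lemma pmf_on_compact_limit:
  fixes K :: "(nat \<Rightarrow> real) set" and p :: "nat \<Rightarrow> (nat \<Rightarrow> real) pmf"
  assumes "compact K" and supp: "\<And>n. set_pmf (p n) \<subseteq> K"
  shows "\<exists>M r. prob_space M \<and> sets M = sets borel \<and> (AE x in M. x \<in> K) \<and> strict_mono (r :: nat \<Rightarrow> nat) \<and>
    (\<forall>g :: (nat \<Rightarrow> real) \<Rightarrow> real. continuous_on UNIV g \<longrightarrow>
       (\<lambda>n. measure_pmf.expectation (p (r n)) g) \<longlonglongrightarrow> (\<integral>x. g x \<partial>M))"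
proof -
  obtain T :: "real set" and \<phi> where T: "compact T" "continuous_on T \<phi>" "\<phi> ` T = K"
    using compact_sequences_image_of_compact_real[OF \<open>compact K\<close>] .
  define \<sigma> where "\<sigma> = inv_into T \<phi>"
  have \<sigma>: "\<sigma> x \<in> T" "\<phi> (\<sigma> x) = x" if "x \<in> K" for x
    using that T(3) by (auto simp: \<sigma>_def inv_into_into f_inv_into_f)
  obtain x0 where "x0 \<in> set_pmf (p 0)" using set_pmf_not_empty[of "p 0"] by auto
  then have "x0 \<in> K" using supp by auto
  then have T_ne: "T \<noteq> {}" using T(3) by auto
  have T_borel: "T \<in> sets borel" by (intro borel_compact T)
  define \<mu> where "\<mu> n = distr (measure_pmf (p n)) borel \<sigma>" for n
  have \<mu>: "real_distribution (\<mu> n)" for n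
    unfolding \<mu>_def real_distribution_def real_distribution_axioms_def
    by (auto intro!: measure_pmf.prob_space_distr)
  have \<mu>_int: "(\<integral>t. G t \<partial>\<mu> n) = measure_pmf.expectation (p n) (\<lambda>x. G (\<sigma> x))"
    if "continuous_on UNIV G" for G :: "real \<Rightarrow> real" and n
    unfolding \<mu>_def by (rule integral_distr) (auto intro: borel_measurable_continuous_onI that)
  obtain R where R: "R > 0" "\<And>t. t \<in> T \<Longrightarrow> \<bar>t\<bar> \<le> R"
    using compact_imp_bounded[OF T(1)] by (auto simp: bounded_pos)
  have m1: "measure (\<mu> n) {- (R + 1)<..R + 1} = 1" for n
  proof -
    have "measure (\<mu> n) {- (R + 1)<..R + 1} = measure (p n) (\<sigma> -` {- (R + 1)<..R + 1})"
      unfolding \<mu>_def by (subst measure_distr) auto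
    also have "\<dots> = 1"
    proof (subst measure_pmf.prob_eq_1, simp, rule AE_pmfI)
      fix x assume "x \<in> set_pmf (p n)"
      then have "\<bar>\<sigma> x\<bar> \<le> R" using R \<sigma> supp by blast
      then show "x \<in> \<sigma> -` {- (R + 1)<..R + 1}" by auto
    qed
    finally show ?thesis .
  qed
  have "tight \<mu>"
    unfolding tight_def
  proof (intro conjI allI impI \<mu>)
    fix e :: real assume "e > 0"
    then show "\<exists>a b. a < b \<and> (\<forall>n. measure (\<mu> n) {a<..b} > 1 - e)"
      using m1 R(1) by (intro exI[of _ "- (R + 1)"] exI[of _ "R + 1"]) simp
  qed
  then obtain r M0 where r: "strict_mono (r :: nat \<Rightarrow> nat)" and M0: "real_distribution M0"
    and wc: "weak_conv_m (\<mu> \<circ> id \<circ> r) M0"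
    using tight_imp_convergent_subsubsequence[of \<mu> id] by (auto simp: strict_mono_def)
  interpret M0: real_distribution M0 by fact
  have lim: "(\<lambda>n. measure_pmf.expectation (p (r n)) (\<lambda>x. G (\<sigma> x))) \<longlonglongrightarrow> (\<integral>t. G t \<partial>M0)"
    if G: "continuous_on UNIV G" "\<And>t. \<bar>G t\<bar> \<le> B" for G :: "real \<Rightarrow> real" and B
  proof -
    have "(\<lambda>n. \<integral>t. G t \<partial>((\<mu> \<circ> id \<circ> r) n)) \<longlonglongrightarrow> (\<integral>t. G t \<partial>M0)"
      by (rule weak_conv_imp_integral_bdd_continuous_conv[OF _ M0 wc, where B = B])
        (use \<mu> G in \<open>auto simp: continuous_on_eq_continuous_at\<close>)
    then show ?thesis using \<mu>_int[OF G(1)] by simp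
  qed
  have AE_T: "AE t in M0. t \<in> T"
  proof -
    \<comment> \<open>A bounded continuous function that vanishes exactly on \<open>T\<close>.\<close>
    define G where "G t = min 1 (infdist t T)" for t
    have G: "continuous_on UNIV G" unfolding G_def by (intro continuous_intros)
    have Gb: "0 \<le> G t" "\<bar>G t\<bar> \<le> 1" for t by (auto simp: G_def infdist_nonneg abs_le_iff min_def intro: order_trans[OF _ infdist_nonneg])
    have "measure_pmf.expectation (p n) (\<lambda>x. G (\<sigma> x)) = 0" for n
    proof -
      have "AE x in measure_pmf (p n). G (\<sigma> x) = 0"
        using \<sigma>(1) supp by (auto simp: AE_measure_pmf_iff G_def subset_iff infdist_zero)
      then show ?thesis by (simp add: integral_cong_AE)
    qed
    then have "(\<integral>t. G t \<partial>M0) = 0" using lim[OF G Gb(2)] by (simp add: LIMSEQ_const_iff)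
    moreover have "integrable M0 G"
      by (rule M0.integrable_const_bound[where B = 1])
        (use Gb borel_measurable_continuous_onI[OF G] in \<open>auto simp: M0.events_eq_borel cong: measurable_cong_sets\<close>)
    ultimately have "AE t in M0. G t = 0"
      using integral_nonneg_eq_0_iff_AE[of M0 G] Gb by simp
    then show ?thesis
    proof (rule AE_mp, intro AE_I2 impI)
      fix t assume "G t = 0"
      then have "infdist t T = 0" by (auto simp: G_def min_def split: if_splits)
      then show "t \<in> T" using in_closed_iff_infdist_zero[OF compact_imp_closed[OF T(1)] T_ne] by simp
    qed
  qed
  define \<phi>' where "\<phi>' t = (if t \<in> T then \<phi> t else x0)" for t
  have \<phi>'_m: "\<phi>' \<in> borel_measurable M0"
    unfolding \<phi>'_def measurable_cong_sets[OF M0.events_eq_borel refl]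
    by (intro borel_measurable_continuous_on_if T_borel T continuous_on_const)
  define M where "M = distr M0 borel \<phi>'"
  show ?thesis
  proof (intro exI[of _ M] exI[of _ r] conjI allI impI)
    show "prob_space M" unfolding M_def by (rule M0.prob_space_distr[OF \<phi>'_m])
    show "sets M = sets borel" by (simp add: M_def)
    have "K \<in> sets borel" by (intro borel_closed compact_imp_closed \<open>compact K\<close>)
    then show "AE x in M. x \<in> K"
      unfolding M_def using T(3) \<open>x0 \<in> K\<close> by (subst AE_distr_iff[OF \<phi>'_m]) (auto simp: \<phi>'_def)
    show "strict_mono r" by fact
    fix g :: "(nat \<Rightarrow> real) \<Rightarrow> real" assume g: "continuous_on UNIV g"
    have g\<phi>: "continuous_on T (\<lambda>t. g (\<phi> t))"
      by (rule continuous_on_compose2[OF g T(2)]) auto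
    then have "bounded ((\<lambda>t. g (\<phi> t)) ` T)"
      by (intro compact_imp_bounded compact_continuous_image T)
    then obtain B where B: "B > 0" "\<And>t. t \<in> T \<Longrightarrow> \<bar>g (\<phi> t)\<bar> \<le> B" by (auto simp: bounded_pos)
    obtain G where G: "continuous_on UNIV G" "\<And>t. t \<in> T \<Longrightarrow> G t = g (\<phi> t)" "\<And>t. norm (G t) \<le> B"
      using Tietze[OF g\<phi>, of UNIV B] B compact_imp_closed[OF T(1)] by auto
    have "(\<integral>x. g x \<partial>M) = (\<integral>t. g (\<phi>' t) \<partial>M0)"
      unfolding M_def by (intro integral_distr \<phi>'_m borel_measurable_continuous_onI g)
    also have "\<dots> = (\<integral>t. G t \<partial>M0)"
    proof (rule integral_cong_AE)
      show "AE t in M0. g (\<phi>' t) = G t" using AE_T by eventually_elim (simp add: \<phi>'_def G)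
      show "(\<lambda>t. g (\<phi>' t)) \<in> borel_measurable M0"
        by (rule borel_measurable_continuous_on[OF g \<phi>'_m])
      show "G \<in> borel_measurable M0"
        unfolding measurable_cong_sets[OF M0.events_eq_borel refl] by (rule borel_measurable_continuous_onI[OF G(1)])
    qed
    finally have gM: "(\<integral>x. g x \<partial>M) = (\<integral>t. G t \<partial>M0)" .
    have "measure_pmf.expectation (p n) (\<lambda>x. G (\<sigma> x)) = measure_pmf.expectation (p n) g" for n
      by (intro integral_cong_AE) (use \<sigma> supp G in \<open>auto simp: AE_measure_pmf_iff subset_iff\<close>)
    then show "(\<lambda>n. measure_pmf.expectation (p (r n)) g) \<longlonglongrightarrow> (\<integral>x. g x \<partial>M)"
      unfolding gM using lim[OF G(1), of B] G(3) by simp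
  qed
qed

text \<open>
  The measures that satisfy the first \<open>n\<close> inequalities up to \<open>1 / (n + 1)\<close> have a weak limit
  point, and it satisfies all of them exactly.
\<close>

theorem countable_moment_alternative:
  fixes K :: "(nat \<Rightarrow> real) set" and H :: "((nat \<Rightarrow> real) \<Rightarrow> real) set"
  assumes "compact K" "countable H" "H \<noteq> {}"
    and cont: "\<And>h. h \<in> H \<Longrightarrow> continuous_on UNIV h"
    and alt: "\<And>F c \<delta>. finite F \<Longrightarrow> F \<subseteq> H \<Longrightarrow> (\<And>h. c h \<ge> 0) \<Longrightarrow> \<delta> > 0 \<Longrightarrow>
      \<exists>x\<in>K. (\<Sum>h\<in>F. c h * h x) > - \<delta>"
  obtains M where "prob_space M" "sets M = sets borel" "AE x in M. x \<in> K"
    "\<And>h. h \<in> H \<Longrightarrow> (\<integral>x. h x \<partial>M) \<ge> 0"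
proof -
  define h where "h = from_nat_into H"
  have h: "h i \<in> H" for i unfolding h_def by (rule from_nat_into) fact
  have "\<exists>B. \<forall>x\<in>K. \<bar>h i x\<bar> \<le> B" for i
  proof -
    have "bounded (h i ` K)"
      by (intro compact_imp_bounded compact_continuous_image continuous_on_subset[OF cont[OF h]] \<open>compact K\<close>) auto
    then show ?thesis by (auto simp: bounded_iff)
  qed
  then obtain b where b: "\<And>i x. x \<in> K \<Longrightarrow> \<bar>h i x\<bar> \<le> b i" by metis
  have "\<exists>p. finite (set_pmf p) \<and> set_pmf p \<subseteq> K \<and>
      (\<forall>i<n. measure_pmf.expectation p (h i) \<ge> - (1 / Suc n))" for n
  proof (rule finitely_supported_alternative[where B = "\<Sum>i<n. \<bar>b i\<bar>"])
    fix i x assume "i < n" "x \<in> K"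
    then have "\<bar>h i x\<bar> \<le> \<bar>b i\<bar>" using b by (meson abs_ge_self order_trans)
    also have "\<dots> \<le> (\<Sum>i<n. \<bar>b i\<bar>)"
      using \<open>i < n\<close> member_le_sum[of i "{..<n}" "\<lambda>i. \<bar>b i\<bar>"] by simp
    finally show "\<bar>h i x\<bar> \<le> (\<Sum>i<n. \<bar>b i\<bar>)" .
  next
    fix c :: "nat \<Rightarrow> real" and \<delta> :: real assume c: "\<And>i. c i \<ge> 0" and "\<delta> > 0"
    define c' where "c' g = (\<Sum>i | i < n \<and> h i = g. c i)" for g
    \<comment> \<open>The enumeration may repeat functions, so weights of equal functions are collected.\<close>
    have "\<exists>x\<in>K. (\<Sum>g\<in>h ` {..<n}. c' g * g x) > - \<delta>"
      using h c \<open>\<delta> > 0\<close> by (intro alt) (auto simp: c'_def intro: sum_nonneg)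
    moreover have "(\<Sum>g\<in>h ` {..<n}. c' g * g x) = (\<Sum>i<n. c i * h i x)" for x
    proof -
      have "(\<Sum>i<n. c i * h i x) = (\<Sum>g\<in>h ` {..<n}. \<Sum>i | i \<in> {..<n} \<and> h i = g. c i * h i x)"
        by (rule sum.image_gen) simp
      also have "\<dots> = (\<Sum>g\<in>h ` {..<n}. c' g * g x)"
        by (intro sum.cong refl) (simp add: c'_def sum_distrib_right)
      finally show ?thesis by simp
    qed
    ultimately show "\<exists>x\<in>K. (\<Sum>i<n. c i * h i x) > - \<delta>" by simp
  qed simp
  then obtain p where p: "\<And>n. set_pmf (p n) \<subseteq> K"
    "\<And>n i. i < n \<Longrightarrow> measure_pmf.expectation (p n) (h i) \<ge> - (1 / Suc n)" by metis
  obtain M r where M: "prob_space M" "sets M = sets borel" "AE x in M. x \<in> K"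
    and r: "strict_mono (r :: nat \<Rightarrow> nat)"
    and lim: "\<And>g :: (nat \<Rightarrow> real) \<Rightarrow> real. continuous_on UNIV g \<Longrightarrow>
       (\<lambda>n. measure_pmf.expectation (p (r n)) g) \<longlonglongrightarrow> (\<integral>x. g x \<partial>M)"
    using pmf_on_compact_limit[of K p, OF \<open>compact K\<close> p(1)] by metis
  have "(\<integral>x. h i x \<partial>M) \<ge> 0" for i
  proof (rule LIMSEQ_le)
    show "(\<lambda>n. measure_pmf.expectation (p (r n)) (h i)) \<longlonglongrightarrow> (\<integral>x. h i x \<partial>M)" by (rule lim[OF cont[OF h]])
    show "(\<lambda>n. - (1 / real (Suc (r n)))) \<longlonglongrightarrow> 0"
      using LIMSEQ_subseq_LIMSEQ[OF tendsto_minus[OF LIMSEQ_inverse_real_of_nat] r]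
      by (simp add: o_def inverse_eq_divide)
    show "\<exists>N. \<forall>n\<ge>N. - (1 / real (Suc (r n))) \<le> measure_pmf.expectation (p (r n)) (h i)"
      using p(2) seq_suble[OF r] by (meson Suc_le_lessD order_trans)
  qed
  moreover have "\<exists>i. h i = g" if "g \<in> H" for g
    using from_nat_into_surj[OF \<open>countable H\<close> that] by (auto simp: h_def)
  ultimately show ?thesis using that[OF M] by metis
qed

section \<open>Coordinates and martingale increments\<close>

lemma space_Rn: "space (Rn d) = PiE {1..d} (\<lambda>_. UNIV)"
  by (simp add: Rn_def space_PiM)

lemma coordinate_measurable_Rn: "i \<in> {1..d} \<Longrightarrow> (\<lambda>x. x i) \<in> borel_measurable (Rn d)"
  unfolding Rn_def by (rule measurable_component_singleton)

text \<open>
  Measurability for the finite product follows from Borel measurability on the space of all sequences,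
  where continuity can be used directly.
\<close>

lemma Rn_embeds_in_sequences: "(\<lambda>x. x) \<in> measurable (Rn d) borel"
proof (rule measurable_coordinatewise_then_product)
  fix i
  show "(\<lambda>x. x i) \<in> borel_measurable (Rn d)"
  proof (cases "i \<in> {1..d}")
    case False
    then have "x i = undefined" if "x \<in> space (Rn d)" for x
      using that unfolding space_Rn by (rule PiE_arb[rotated])
    then show ?thesis by (subst measurable_cong[where g = "\<lambda>_. undefined"]) auto
  qed (rule coordinate_measurable_Rn)
qed

lemma continuous_restrict_coordinates:
  "continuous_on UNIV (\<lambda>y :: nat \<Rightarrow> real. restrict y A)"
proof (rule continuous_on_coordinatewise_then_product)
  fix i show "continuous_on UNIV (\<lambda>y :: nat \<Rightarrow> real. restrict y A i)"
    by (cases "i \<in> A") auto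
qed

lemma continuous_imp_measurable_Rn:
  fixes f :: "(nat \<Rightarrow> real) \<Rightarrow> real"
  assumes "continuous_on (PiE {1..d} (\<lambda>_. UNIV)) f"
  shows "f \<in> borel_measurable (Rn d)"
proof -
  have c: "continuous_on UNIV (\<lambda>y. f (restrict y {1..d}))"
    by (rule continuous_on_compose2[OF assms continuous_restrict_coordinates]) auto
  have "(\<lambda>x. f (restrict x {1..d})) \<in> borel_measurable (Rn d)"
    by (rule borel_measurable_continuous_on[OF c Rn_embeds_in_sequences])
  then show ?thesis
    by (rule measurable_cong[THEN iffD1, rotated]) (auto simp: space_Rn PiE_restrict)
qed

lemma measurable_restrict_Rn:
  assumes "k \<le> d" shows "(\<lambda>x. restrict x {1..k}) \<in> measurable (Rn d) (Rn k)"
  unfolding Rn_def using assms by (intro measurable_restrict_subset) auto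

lemma coord_algebra_subalgebra:
  assumes "sets \<pi> = sets (Rn d)" "k \<le> d"
  shows "subalgebra \<pi> (coord_algebra \<pi> k)"
proof -
  have sp: "space \<pi> = space (Rn d)" by (rule sets_eq_imp_space_eq) fact
  have r: "(\<lambda>x. restrict x {1..k}) \<in> measurable \<pi> (Rn k)"
    using measurable_restrict_Rn[OF assms(2)] measurable_cong_sets[OF assms(1) refl] by blast
  then have "sets (coord_algebra \<pi> k) \<subseteq> sets \<pi>"
    unfolding coord_algebra_def by (rule measurable_iff_sets[THEN iffD1, THEN conjunct2])
  then show ?thesis by (simp add: subalgebra_def coord_algebra_def)
qed

lemma coord_algebra_measurable:
  assumes "a \<in> borel_measurable (Rn k)" "(\<lambda>x. restrict x {1..k}) \<in> space \<pi> \<rightarrow> space (Rn k)"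
  shows "(\<lambda>x. a (restrict x {1..k})) \<in> borel_measurable (coord_algebra \<pi> k)"
  unfolding coord_algebra_def
  by (rule measurable_compose[OF measurable_vimage_algebra1[OF assms(2)] assms(1)])

lemma restrict_into_space_Rn: "(\<lambda>x. restrict x {1..k}) \<in> A \<rightarrow> space (Rn k)"
  by (auto simp: space_Rn)

lemma bounded_mult_integrable:
  fixes a g :: "'a \<Rightarrow> real"
  assumes "integrable M g" "a \<in> borel_measurable M" "\<And>x. \<bar>a x\<bar> \<le> B"
  shows "integrable M (\<lambda>x. a x * g x)"
proof (rule Bochner_Integration.integrable_bound[where f = "\<lambda>x. B * g x"])
  show "AE x in M. norm (a x * g x) \<le> norm (B * g x)"
    using assms(3) by (intro AE_I2) (auto simp: abs_mult intro!: mult_right_mono order_trans[OF assms(3) abs_ge_self])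
qed (use assms in auto)

text \<open>
  The increment has conditional mean zero given the past, and \<open>a\<close> depends on the past only.
\<close>

lemma martingale_increment_orthogonal:
  assumes "martingale_measure d \<pi>" "k \<in> {1..<d}" "a \<in> borel_measurable (Rn k)" "\<And>y. \<bar>a y\<bar> \<le> B"
  shows "integrable \<pi> (\<lambda>x. a (restrict x {1..k}) * (x (Suc k) - x k))"
    and "(\<integral>x. a (restrict x {1..k}) * (x (Suc k) - x k) \<partial>\<pi>) = 0"
proof -
  let ?F = "coord_algebra \<pi> k" and ?a = "\<lambda>x. a (restrict x {1..k})"
  have \<pi>: "prob_space \<pi>" "sets \<pi> = sets (Rn d)" and int: "\<And>i. i \<in> {1..d} \<Longrightarrow> integrable \<pi> (\<lambda>x. x i)"
    and ce: "AE x in \<pi>. real_cond_exp \<pi> ?F (\<lambda>x. x (Suc k)) x = x k"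
    using assms(1,2) by (auto simp: martingale_measure_def prob_Rn_def)
  interpret prob_space \<pi> by fact
  interpret finite_measure_subalgebra \<pi> ?F
    using coord_algebra_subalgebra[OF \<pi>(2), of k] assms(2) by unfold_locales auto
  have aF: "?a \<in> borel_measurable ?F"
    by (rule coord_algebra_measurable[OF assms(3) restrict_into_space_Rn])
  have a\<pi>: "?a \<in> borel_measurable \<pi>" by (rule measurable_from_subalg[OF subalg aF])
  have k: "Suc k \<in> {1..d}" "k \<in> {1..d}" using assms(2) by auto
  have i1: "integrable \<pi> (\<lambda>x. ?a x * x (Suc k))" and i2: "integrable \<pi> (\<lambda>x. ?a x * x k)"
    using int k assms(4) a\<pi> by (auto intro!: bounded_mult_integrable[where B = B])
  show "integrable \<pi> (\<lambda>x. ?a x * (x (Suc k) - x k))"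
    using i1 i2 by (simp add: right_diff_distrib)
  have "(\<integral>x. ?a x * x (Suc k) \<partial>\<pi>) = (\<integral>x. ?a x * real_cond_exp \<pi> ?F (\<lambda>x. x (Suc k)) x \<partial>\<pi>)"
    using real_cond_exp_intg(2)[OF i1 aF] int[OF k(1)] by auto
  also have "\<dots> = (\<integral>x. ?a x * x k \<partial>\<pi>)"
  proof (rule integral_cong_AE)
    show "AE x in \<pi>. ?a x * real_cond_exp \<pi> ?F (\<lambda>x. x (Suc k)) x = ?a x * x k"
      using ce by eventually_elim simp
    show "(\<lambda>x. ?a x * real_cond_exp \<pi> ?F (\<lambda>x. x (Suc k)) x) \<in> borel_measurable \<pi>"
      using a\<pi> by (intro borel_measurable_times borel_measurable_cond_exp2)
  qed (use i2 in auto)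
  finally show "(\<integral>x. ?a x * (x (Suc k) - x k) \<partial>\<pi>) = 0"
    using i1 i2 by (simp add: right_diff_distrib)
qed

section \<open>Weak duality\<close>

lemma mart_ball_onE:
  assumes "\<pi> \<in> mart_ball_on d \<Lambda> \<nu> \<epsilon>"
  shows "martingale_measure d \<pi>" "prob_space \<pi>" "sets \<pi> = sets (Rn d)"
    "\<And>i. i \<in> {1..d} \<Longrightarrow> (\<integral>x. x i \<partial>\<pi>) = 0" "marginal_dist d \<nu> \<pi> \<le> ennreal \<epsilon>"
    "AE x in \<pi>. x \<in> PiE {1..d} \<Lambda>"
proof -
  show mm: "martingale_measure d \<pi>" "prob_space \<pi>" "sets \<pi> = sets (Rn d)" "marginal_dist d \<nu> \<pi> \<le> ennreal \<epsilon>"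
    using assms by (auto simp: mart_ball_on_def mart_ball_def centered_martingale_measures_def
        martingale_measure_def prob_Rn_def)
  show "(\<integral>x. x i \<partial>\<pi>) = 0" if "i \<in> {1..d}" for i
  proof -
    have "(\<integral>x. x \<partial>marginal \<pi> i) = 0"
      using assms that by (auto simp: mart_ball_on_def mart_ball_def centered_martingale_measures_def)
    moreover have "(\<lambda>x. x i) \<in> borel_measurable \<pi>"
      using coordinate_measurable_Rn[OF that] measurable_cong_sets[OF mm(3) refl] by blast
    ultimately show ?thesis unfolding marginal_def by (subst (asm) integral_distr) auto
  qed
  have "emeasure \<pi> (PiE {1..d} \<Lambda>) = 1" "PiE {1..d} \<Lambda> \<in> sets \<pi>"
    using assms mm by (auto simp: mart_ball_on_def prob_on_def)
  then show "AE x in \<pi>. x \<in> PiE {1..d} \<Lambda>"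
    using prob_space.AE_in_set_eq_1[OF mm(2)] by (simp add: measure_def)
qed

lemma continuous_on_compact_bounded:
  fixes g :: "'a::topological_space \<Rightarrow> real"
  assumes "compact K" "continuous_on K g"
  obtains B where "B \<ge> 0" "\<And>x. x \<in> K \<Longrightarrow> \<bar>g x\<bar> \<le> B"
proof -
  have "bounded (g ` K)" by (intro compact_imp_bounded compact_continuous_image assms)
  then show ?thesis using that by (auto simp: bounded_pos intro: less_imp_le)
qed

lemma coupling_of_almost_optimal_cost:
  assumes "marginal_dist d \<nu> \<pi> < ennreal c"
  obtains \<mu> \<pi>' where "\<pi>' \<in> with_marginals d \<nu>" "\<mu> \<in> couplings d \<pi> \<pi>'"
    "(\<integral>\<^sup>+p. ennreal (l1_dist d (fst p) (snd p)) \<partial>\<mu>) < ennreal c"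
  using assms unfolding marginal_dist_def wasserstein_def INF_less_iff case_prod_beta by blast

text \<open>
  The dual constraint is integrated against a coupling whose cost exceeds \<open>\<epsilon>\<close> by at most \<open>e\<close>;
  since such a coupling need not exist for \<open>e = 0\<close>, the bound is obtained by letting \<open>e\<close> tend to 0.
\<close>

theorem weak_duality:
  assumes "d \<ge> 1"
    and f: "continuous_on (PiE {1..d} (\<lambda>_. UNIV)) f"
    and \<Lambda>: "\<And>i. i \<in> {1..d} \<Longrightarrow> compact (\<Lambda> i)"
    and \<nu>: "\<And>i. i \<in> {1..d} \<Longrightarrow> prob_space (\<nu> i)" "\<And>i. i \<in> {1..d} \<Longrightarrow> sets (\<nu> i) = sets borel"
    and "\<epsilon> \<ge> 0" and \<pi>: "\<pi> \<in> mart_ball_on d \<Lambda> \<nu> \<epsilon>"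
    and feas: "(\<gamma>, \<eta>, \<alpha>, \<beta>) \<in> dual_feasible d f \<Lambda>"
  shows "(\<integral>x. f x \<partial>\<pi>) \<le> \<gamma> * \<epsilon> + (\<Sum>k\<in>{1..d}. \<integral>x. \<beta> k x \<partial>\<nu> k)"
proof -
  note \<pi>_props = mart_ball_onE[OF \<pi>]
  interpret P: prob_space \<pi> by (rule \<pi>_props)
  have m\<pi>: "g \<in> borel_measurable \<pi>" if "g \<in> borel_measurable (Rn d)" for g :: "(nat \<Rightarrow> real) \<Rightarrow> real"
    using that measurable_cong_sets[OF \<pi>_props(3) refl] by blast
  have \<gamma>: "\<gamma> \<ge> 0" and \<alpha>: "\<And>k. k \<in> {1..d - 1} \<Longrightarrow> continuous_on (PiE {1..k} \<Lambda>) (\<alpha> k)"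
    and \<beta>: "\<And>k. k \<in> {1..d} \<Longrightarrow> continuous_on UNIV (\<beta> k)" "\<And>k. k \<in> {1..d} \<Longrightarrow> bounded (range (\<beta> k))"
    and ineq: "\<And>x x'. x \<in> PiE {1..d} (\<lambda>_. UNIV) \<Longrightarrow> x' \<in> PiE {1..d} \<Lambda> \<Longrightarrow>
           f x' + (\<Sum>k\<in>{1..d - 1}. \<alpha> k (restrict x' {1..k}) * (x' (Suc k) - x' k))
             - \<gamma> * l1_dist d x x' - (\<Sum>k\<in>{1..d}. \<beta> k (x k)) + \<eta> * x' 1 \<le> 0"
    using feas by (auto simp: dual_feasible_def)
  have f_int: "integrable \<pi> f"
  proof -
    obtain B where "\<And>x. x \<in> PiE {1..d} \<Lambda> \<Longrightarrow> \<bar>f x\<bar> \<le> B"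
      using continuous_on_compact_bounded[OF compact_PiE continuous_on_subset[OF f]] \<Lambda>
      by (metis PiE_mono subset_UNIV)
    then show ?thesis
      using \<pi>_props(6) by (intro P.integrable_const_bound[where B = B] m\<pi> continuous_imp_measurable_Rn f) auto
  qed
  \<comment> \<open>The functions \<open>\<alpha> k\<close> are controlled on the support only, so they are cut off outside of it.\<close>
  define a where "a k y = (if y \<in> PiE {1..k} \<Lambda> then \<alpha> k y else 0)" for k y
  have a: "integrable \<pi> (\<lambda>x. a k (restrict x {1..k}) * (x (Suc k) - x k))"
    "(\<integral>x. a k (restrict x {1..k}) * (x (Suc k) - x k) \<partial>\<pi>) = 0" if k: "k \<in> {1..d - 1}" for k
  proof -
    have K: "compact (PiE {1..k} \<Lambda>)" using k \<Lambda> by (intro compact_PiE) auto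
    obtain B where "B \<ge> 0" "\<And>y. y \<in> PiE {1..k} \<Lambda> \<Longrightarrow> \<bar>\<alpha> k y\<bar> \<le> B"
      using continuous_on_compact_bounded[OF K \<alpha>[OF k]] by metis
    then have B: "\<bar>a k y\<bar> \<le> B" for y by (auto simp: a_def)
    have "a k \<in> borel_measurable borel" unfolding a_def
      using K by (intro borel_measurable_continuous_on_if \<alpha> k) (auto intro: borel_closed compact_imp_closed)
    then have am: "a k \<in> borel_measurable (Rn k)" by (rule measurable_compose[OF Rn_embeds_in_sequences])
    show "integrable \<pi> (\<lambda>x. a k (restrict x {1..k}) * (x (Suc k) - x k))"
      "(\<integral>x. a k (restrict x {1..k}) * (x (Suc k) - x k) \<partial>\<pi>) = 0"
      using k martingale_increment_orthogonal[OF \<pi>_props(1) _ am B] by auto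
  qed
  have x1: "integrable \<pi> (\<lambda>x. x 1)" "(\<integral>x. x 1 \<partial>\<pi>) = 0"
    using \<pi>_props(1,4) \<open>d \<ge> 1\<close> by (auto simp: martingale_measure_def)
  define U where "U x = f x + (\<Sum>k\<in>{1..d - 1}. a k (restrict x {1..k}) * (x (Suc k) - x k)) + \<eta> * x 1" for x
  define A where "A x = (\<Sum>k\<in>{1..d - 1}. a k (restrict x {1..k}) * (x (Suc k) - x k))" for x
  have A: "integrable \<pi> A" "(\<integral>x. A x \<partial>\<pi>) = 0"
  proof -
    show "integrable \<pi> A" unfolding A_def by (rule Bochner_Integration.integrable_sum[OF a(1)])
    have "(\<integral>x. A x \<partial>\<pi>) = (\<Sum>k\<in>{1..d - 1}. \<integral>x. a k (restrict x {1..k}) * (x (Suc k) - x k) \<partial>\<pi>)"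
      unfolding A_def by (rule Bochner_Integration.integral_sum[OF a(1)])
    also have "\<dots> = 0" by (rule sum.neutral) (simp add: a(2) del: One_nat_def)
    finally show "(\<integral>x. A x \<partial>\<pi>) = 0" .
  qed
  have U_eq: "U = (\<lambda>x. f x + A x + \<eta> * x 1)" by (simp add: U_def A_def fun_eq_iff)
  have U: "integrable \<pi> U" "(\<integral>x. U x \<partial>\<pi>) = (\<integral>x. f x \<partial>\<pi>)"
    unfolding U_eq using f_int A x1 by (simp_all del: One_nat_def)
  have "(\<integral>x. f x \<partial>\<pi>) \<le> \<gamma> * (\<epsilon> + e) + (\<Sum>k\<in>{1..d}. \<integral>x. \<beta> k x \<partial>\<nu> k)" if "e > 0" for e
  proof -
    have "marginal_dist d \<nu> \<pi> < ennreal (\<epsilon> + e)"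
      using \<pi>_props(5) \<open>e > 0\<close> \<open>\<epsilon> \<ge> 0\<close> by (auto intro: order.strict_trans1 simp: ennreal_less_iff)
    then obtain \<mu> \<pi>' where \<pi>': "\<pi>' \<in> with_marginals d \<nu>" and \<mu>: "\<mu> \<in> couplings d \<pi> \<pi>'"
      and cost: "(\<integral>\<^sup>+p. ennreal (l1_dist d (fst p) (snd p)) \<partial>\<mu>) < ennreal (\<epsilon> + e)"
      by (rule coupling_of_almost_optimal_cost)
    have \<mu>_sets: "sets \<mu> = sets (Rn d \<Otimes>\<^sub>M Rn d)" and fst_\<mu>: "distr \<mu> (Rn d) fst = \<pi>"
      and snd_\<mu>: "distr \<mu> (Rn d) snd = \<pi>'" and "prob_space \<mu>"
      using \<mu> by (auto simp: couplings_def)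
    interpret \<mu>: prob_space \<mu> by fact
    have fst_m: "fst \<in> measurable \<mu> (Rn d)" and snd_m: "snd \<in> measurable \<mu> (Rn d)"
      by (auto simp: measurable_cong_sets[OF \<mu>_sets refl])
    have U\<mu>: "integrable \<mu> (\<lambda>p. U (fst p))" "(\<integral>p. U (fst p) \<partial>\<mu>) = (\<integral>x. U x \<partial>\<pi>)"
    proof -
      have Um: "U \<in> borel_measurable (Rn d)"
        using U(1) measurable_cong_sets[OF \<pi>_props(3) refl] by (auto dest: borel_measurable_integrable)
      show "integrable \<mu> (\<lambda>p. U (fst p))"
        using U(1) integrable_distr_eq[OF fst_m Um] by (simp add: fst_\<mu>)
      show "(\<integral>p. U (fst p) \<partial>\<mu>) = (\<integral>x. U x \<partial>\<pi>)"
        using integral_distr[OF fst_m Um] by (simp add: fst_\<mu>)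
    qed
    have \<beta>\<mu>: "integrable \<mu> (\<lambda>p. \<beta> k (snd p k))" "(\<integral>p. \<beta> k (snd p k) \<partial>\<mu>) = (\<integral>x. \<beta> k x \<partial>\<nu> k)"
      if k: "k \<in> {1..d}" for k
    proof -
      have \<beta>m: "\<beta> k \<in> borel_measurable borel" by (rule borel_measurable_continuous_onI[OF \<beta>(1)[OF k]])
      have c: "(\<lambda>x. x k) \<in> borel_measurable (Rn d)" by (rule coordinate_measurable_Rn[OF k])
      have sk: "(\<lambda>p. snd p k) \<in> borel_measurable \<mu>" by (rule measurable_compose[OF snd_m c])
      have "\<nu> k = distr \<pi>' borel (\<lambda>x. x k)" using \<pi>' k by (auto simp: with_marginals_def marginal_def)
      also have "\<dots> = distr \<mu> borel (\<lambda>p. snd p k)"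
        unfolding snd_\<mu>[symmetric] by (subst distr_distr[OF c snd_m]) (simp add: o_def)
      finally show "(\<integral>p. \<beta> k (snd p k) \<partial>\<mu>) = (\<integral>x. \<beta> k x \<partial>\<nu> k)"
        using integral_distr[OF sk \<beta>m] by simp
      obtain B where "\<And>x. \<bar>\<beta> k x\<bar> \<le> B" using \<beta>(2)[OF k] by (auto simp: bounded_iff)
      then show "integrable \<mu> (\<lambda>p. \<beta> k (snd p k))"
        by (intro \<mu>.integrable_const_bound[where B = B] measurable_compose[OF sk \<beta>m]) auto
    qed
    have l_m: "(\<lambda>p. l1_dist d (fst p) (snd p)) \<in> borel_measurable \<mu>"
      unfolding l1_dist_def
      by (intro borel_measurable_sum borel_measurable_abs borel_measurable_diff
          measurable_compose[OF fst_m coordinate_measurable_Rn] measurable_compose[OF snd_m coordinate_measurable_Rn])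
    have l_nn: "0 \<le> l1_dist d x y" for x y by (auto simp: l1_dist_def intro: sum_nonneg)
    have l_int: "integrable \<mu> (\<lambda>p. l1_dist d (fst p) (snd p))"
      using cost l_nn by (intro integrableI_bounded l_m) (auto simp: less_top[symmetric] top.extremum_strict dest: order.strict_trans intro: order.strict_trans)
    have l_le: "(\<integral>p. l1_dist d (fst p) (snd p) \<partial>\<mu>) \<le> \<epsilon> + e"
    proof -
      have "ennreal (\<integral>p. l1_dist d (fst p) (snd p) \<partial>\<mu>) < ennreal (\<epsilon> + e)"
        using nn_integral_eq_integral[OF l_int] l_nn cost by simp
      then show ?thesis using \<open>e > 0\<close> \<open>\<epsilon> \<ge> 0\<close> by (subst (asm) ennreal_less_iff) (auto simp: l_nn)
    qed
    have AE_\<Lambda>: "AE p in \<mu>. fst p \<in> PiE {1..d} \<Lambda>"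
    proof (rule AE_distrD[OF fst_m])
      show "AE x in distr \<mu> (Rn d) fst. x \<in> PiE {1..d} \<Lambda>" unfolding fst_\<mu> by (rule \<pi>_props)
    qed
    have \<beta>_sum: "integrable \<mu> (\<lambda>p. \<Sum>k\<in>{1..d}. \<beta> k (snd p k))"
      "(\<integral>p. (\<Sum>k\<in>{1..d}. \<beta> k (snd p k)) \<partial>\<mu>) = (\<Sum>k\<in>{1..d}. \<integral>x. \<beta> k x \<partial>\<nu> k)"
    proof -
      show "integrable \<mu> (\<lambda>p. \<Sum>k\<in>{1..d}. \<beta> k (snd p k))"
        by (rule Bochner_Integration.integrable_sum[OF \<beta>\<mu>(1)])
      have "(\<integral>p. (\<Sum>k\<in>{1..d}. \<beta> k (snd p k)) \<partial>\<mu>) = (\<Sum>k\<in>{1..d}. \<integral>p. \<beta> k (snd p k) \<partial>\<mu>)"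
        by (rule Bochner_Integration.integral_sum[OF \<beta>\<mu>(1)])
      also have "\<dots> = (\<Sum>k\<in>{1..d}. \<integral>x. \<beta> k x \<partial>\<nu> k)" by (rule sum.cong[OF refl \<beta>\<mu>(2)])
      finally show "(\<integral>p. (\<Sum>k\<in>{1..d}. \<beta> k (snd p k)) \<partial>\<mu>) = (\<Sum>k\<in>{1..d}. \<integral>x. \<beta> k x \<partial>\<nu> k)" .
    qed
    have "(\<integral>x. f x \<partial>\<pi>) = (\<integral>p. U (fst p) \<partial>\<mu>)" using U U\<mu> by simp
    also have "\<dots> \<le> (\<integral>p. \<gamma> * l1_dist d (fst p) (snd p) + (\<Sum>k\<in>{1..d}. \<beta> k (snd p k)) \<partial>\<mu>)"
    proof (rule integral_mono_AE)
      show "AE p in \<mu>. U (fst p) \<le> \<gamma> * l1_dist d (fst p) (snd p) + (\<Sum>k\<in>{1..d}. \<beta> k (snd p k))"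
        using AE_\<Lambda> AE_space
      proof eventually_elim
        fix p assume p: "fst p \<in> PiE {1..d} \<Lambda>" "p \<in> space \<mu>"
        have "snd p \<in> PiE {1..d} (\<lambda>_. UNIV)" using measurable_space[OF snd_m p(2)] by (simp add: space_Rn)
        note ineq[OF this p(1)]
        moreover have "(\<Sum>k\<in>{1..d - 1}. a k (restrict (fst p) {1..k}) * (fst p (Suc k) - fst p k))
           = (\<Sum>k\<in>{1..d - 1}. \<alpha> k (restrict (fst p) {1..k}) * (fst p (Suc k) - fst p k))"
          using p(1) by (intro sum.cong refl) (auto simp: a_def PiE_iff)
        moreover have "l1_dist d (snd p) (fst p) = l1_dist d (fst p) (snd p)"
          by (simp add: l1_dist_def abs_minus_commute)
        ultimately show "U (fst p) \<le> \<gamma> * l1_dist d (fst p) (snd p) + (\<Sum>k\<in>{1..d}. \<beta> k (snd p k))"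
          by (simp add: U_def)
      qed
    qed (use U\<mu> l_int \<beta>_sum in auto)
    also have "\<dots> = \<gamma> * (\<integral>p. l1_dist d (fst p) (snd p) \<partial>\<mu>) + (\<Sum>k\<in>{1..d}. \<integral>x. \<beta> k x \<partial>\<nu> k)"
      using l_int \<beta>_sum by simp
    also have "\<dots> \<le> \<gamma> * (\<epsilon> + e) + (\<Sum>k\<in>{1..d}. \<integral>x. \<beta> k x \<partial>\<nu> k)"
      using mult_left_mono[OF l_le \<gamma>] by simp
    finally show ?thesis .
  qed
  note bound = this
  show ?thesis
  proof (rule field_le_epsilon)
    fix e :: real assume "e > 0"
    have "\<gamma> * (e / (\<gamma> + 1)) \<le> e" using \<gamma> \<open>e > 0\<close> by (simp add: field_simps)
    moreover have "(\<integral>x. f x \<partial>\<pi>) \<le> \<gamma> * (\<epsilon> + e / (\<gamma> + 1)) + (\<Sum>k\<in>{1..d}. \<integral>x. \<beta> k x \<partial>\<nu> k)"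
      using bound[of "e / (\<gamma> + 1)"] \<gamma> \<open>e > 0\<close> by simp
    ultimately show "(\<integral>x. f x \<partial>\<pi>) \<le> \<gamma> * \<epsilon> + (\<Sum>k\<in>{1..d}. \<integral>x. \<beta> k x \<partial>\<nu> k) + e"
      by (simp add: distrib_left)
  qed
qed

section \<open>Ramps as test functions\<close>

text \<open>
  Continuous approximations from above of the indicator of a half-line. Rational thresholds and integer
  slopes keep the family of test functions countable.
\<close>

definition ramp :: "rat \<Rightarrow> nat \<Rightarrow> real \<Rightarrow> real" where
  "ramp q n x = max 0 (min 1 (1 - real n * (x - of_rat q)))"

lemma ramp_bounds: "0 \<le> ramp q n x" "ramp q n x \<le> 1"
  by (auto simp: ramp_def)

lemma continuous_ramp: "continuous_on UNIV (ramp q n)"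
  unfolding ramp_def by (intro continuous_intros)

lemma ramp_measurable [measurable]: "ramp q n \<in> borel_measurable borel"
  by (rule borel_measurable_continuous_onI[OF continuous_ramp])

lemma ramp_tendsto_indicator: "(\<lambda>n. ramp q n x) \<longlonglongrightarrow> indicator {..of_rat q} x"
proof (cases "x \<le> of_rat q")
  case True
  then have "real n * (x - of_rat q) \<le> 0" for n by (intro mult_nonneg_nonpos) auto
  then have "ramp q n x = 1" for n by (simp add: ramp_def min_def)
  then show ?thesis using True by simp
next
  case False
  then obtain N :: nat where N: "1 / (x - of_rat q) \<le> real N" using real_arch_simple by blast
  have "ramp q n x = 0" if "n \<ge> N" for n
  proof -
    have "1 / (x - of_rat q) \<le> real n" using N that by linarith
    then have "1 \<le> real n * (x - of_rat q)" using False by (simp add: field_simps)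
    then show ?thesis by (simp add: ramp_def max_def)
  qed
  then have "\<forall>\<^sub>F n in sequentially. ramp q n x = 0" by (auto simp: eventually_sequentially)
  then show ?thesis using False by (simp add: tendsto_eventually)
qed

definition rational_halflines :: "real set set" where
  "rational_halflines = range (\<lambda>q::rat. {..of_rat q})"

lemma borel_eq_rational_halflines: "borel = sigma UNIV rational_halflines"
  unfolding rational_halflines_def
proof (rule borel_eq_sigmaI1[OF borel_eq_atMost])
  fix X :: "real set" assume "X \<in> range atMost"
  then obtain a where X: "X = {..a}" by auto
  let ?Q = "{q::rat. a \<le> of_rat q}"
  have "?Q \<noteq> {}" using of_rat_dense[of a "a + 1"] by (auto intro: less_imp_le)
  moreover have "X = (\<Inter>q\<in>?Q. {..of_rat q})"
  proof -
    have "x \<le> a" if *: "\<forall>q::rat. a \<le> of_rat q \<longrightarrow> x \<le> of_rat q" for x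
    proof (rule ccontr)
      assume "\<not> x \<le> a"
      then obtain q where "a < of_rat q" "of_rat q < x" using of_rat_dense[of a x] by auto
      then show False using *[rule_format, of q] by linarith
    qed
    then show ?thesis by (auto simp: X)
  qed
  ultimately show "X \<in> sets (sigma UNIV (range (\<lambda>q::rat. {..of_rat q})))"
    by (simp only:) (rule sets.countable_INT'', auto simp: sigma_sets_top)
qed auto

lemma Int_rational_halflines:
  assumes "A \<in> rational_halflines" "B \<in> rational_halflines" shows "A \<inter> B \<in> rational_halflines"
proof -
  obtain p q where AB: "A = {..of_rat p}" "B = {..of_rat q}" using assms by (auto simp: rational_halflines_def)
  have "A \<inter> B = {..of_rat (min p q)}" by (auto simp: AB min_def of_rat_less_eq intro: order_trans)
  then show ?thesis by (auto simp: rational_halflines_def)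
qed

lemma atMost_nat_rational_halfline: "{..real n} \<in> rational_halflines"
  unfolding rational_halflines_def by (rule range_eqI[of _ _ "of_nat n"]) simp

lemma Un_rational_halflines: "(\<Union>i::nat. {..real_of_rat (of_nat i)}) = UNIV"
  using real_arch_simple by auto

text \<open>
  As the slope grows, the integrals of ramps converge to the distribution function at the rational
  thresholds.
\<close>

lemma prob_eqI_ramp:
  assumes "prob_space M" "sets M = sets borel" "prob_space N" "sets N = sets borel"
    and eq: "\<And>q n. (\<integral>x. ramp q n x \<partial>M) = (\<integral>x. ramp q n x \<partial>N)"
  shows "M = N"
proof -
  have lim: "(\<lambda>n. \<integral>x. ramp q n x \<partial>P) \<longlonglongrightarrow> measure P {..of_rat q}"
    if P: "prob_space P" "sets P = sets borel" for P :: "real measure" and q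
  proof -
    interpret prob_space P by fact
    have "(\<lambda>n. \<integral>x. ramp q n x \<partial>P) \<longlonglongrightarrow> (\<integral>x. indicator {..of_rat q} x \<partial>P)"
      using P(2) ramp_bounds
      by (intro integral_dominated_convergence[where w = "\<lambda>_. 1"] AE_I2 ramp_tendsto_indicator)
        (auto cong: measurable_cong_sets)
    then show ?thesis by (simp add: P(2))
  qed
  interpret M: prob_space M by fact
  interpret N: prob_space N by fact
  have "measure M {..of_rat q} = measure N {..of_rat q}" for q
    using LIMSEQ_unique[OF lim[OF assms(1,2)]] lim[OF assms(3,4)] by (simp add: eq)
  then have "emeasure M X = emeasure N X" if "X \<in> rational_halflines" for X
    using that by (auto simp: rational_halflines_def M.emeasure_eq_measure N.emeasure_eq_measure)
  then show ?thesis
  proof (rule measure_eqI_generator_eq[where \<Omega> = UNIV and E = rational_halflines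
        and A = "\<lambda>i. {..of_rat (of_nat i)}", rotated 2])
    show "Int_stable rational_halflines" by (auto simp: Int_stable_def Int_rational_halflines)
    have "sets borel = sigma_sets UNIV rational_halflines"
      by (subst borel_eq_rational_halflines) simp
    then show "sets M = sigma_sets UNIV rational_halflines" "sets N = sigma_sets UNIV rational_halflines"
      using assms by auto
    show "range (\<lambda>i. {..of_rat (of_nat i)}) \<subseteq> rational_halflines"
      by (auto simp: atMost_nat_rational_halfline)
  qed (use Un_rational_halflines in auto)
qed

definition rational_boxes :: "nat \<Rightarrow> (nat \<Rightarrow> real) set set" where
  "rational_boxes k = range (\<lambda>q :: nat \<Rightarrow> rat. PiE {1..k} (\<lambda>i. {..of_rat (q i)}))"

lemma sets_Rn_eq_rational_boxes:
  "sets (Rn k) = sigma_sets (PiE {1..k} (\<lambda>_. UNIV)) (rational_boxes k)"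
proof -
  let ?P = "{{f \<in> PiE {1..k} (\<lambda>_. UNIV). \<forall>i\<in>j. f i \<in> A i} | A j.
      j \<in> {{1..k}} \<and> A \<in> Pi j (\<lambda>_. rational_halflines)}"
  have "sets (Rn k) = sets (PiM {1..k} (\<lambda>_. sigma UNIV rational_halflines))"
    unfolding Rn_def using borel_eq_rational_halflines by simp
  also have "\<dots> = sets (sigma (PiE {1..k} (\<lambda>_. UNIV)) ?P)"
  proof (rule sets_PiM_sigma)
    show "\<exists>S\<subseteq>rational_halflines. countable S \<and> UNIV = \<Union>S"
      using Un_rational_halflines
      by (intro exI[of _ "range (\<lambda>i::nat. {..real_of_rat (of_nat i)})"]) (auto simp: atMost_nat_rational_halfline)
  qed auto
  also have "?P = rational_boxes k"
  proof (intro equalityI subsetI)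
    fix X assume "X \<in> ?P"
    then obtain A where A: "X = {f \<in> PiE {1..k} (\<lambda>_. UNIV). \<forall>i\<in>{1..k}. f i \<in> A i}"
      "A \<in> Pi {1..k} (\<lambda>_. rational_halflines)" by auto
    then have "\<forall>i\<in>{1..k}. \<exists>q. A i = {..of_rat q}" by (auto simp: rational_halflines_def Pi_iff)
    then obtain q where "\<forall>i\<in>{1..k}. A i = {..of_rat (q i)}" by metis
    then have "X = PiE {1..k} (\<lambda>i. {..of_rat (q i)})" unfolding A(1) by (auto simp: PiE_iff extensional_def)
    then show "X \<in> rational_boxes k" by (auto simp: rational_boxes_def)
  next
    fix X assume "X \<in> rational_boxes k"
    then obtain q where X: "X = PiE {1..k} (\<lambda>i. {..of_rat (q i)})" by (auto simp: rational_boxes_def)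
    show "X \<in> ?P" unfolding X
      by (rule CollectI, rule exI[of _ "\<lambda>i. {..of_rat (q i)}"], rule exI[of _ "{1..k}"])
        (auto simp: rational_halflines_def PiE_iff extensional_def)
  qed
  also have "sets (sigma (PiE {1..k} (\<lambda>_. UNIV)) (rational_boxes k))
      = sigma_sets (PiE {1..k} (\<lambda>_. UNIV)) (rational_boxes k)"
    by (rule sets_measure_of) (auto simp: rational_boxes_def PiE_iff)
  finally show ?thesis .
qed

lemma Int_stable_rational_boxes: "Int_stable (rational_boxes k)"
proof (rule Int_stableI)
  fix A B assume "A \<in> rational_boxes k" "B \<in> rational_boxes k"
  then obtain p q where AB: "A = PiE {1..k} (\<lambda>i. {..of_rat (p i)})" "B = PiE {1..k} (\<lambda>i. {..of_rat (q i)})"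
    by (auto simp: rational_boxes_def)
  have "{..real_of_rat (p i)} \<inter> {..of_rat (q i)} = {..of_rat (min (p i) (q i))}" for i
    by (auto simp: min_def of_rat_less_eq intro: order_trans)
  then have "A \<inter> B = PiE {1..k} (\<lambda>i. {..of_rat (min (p i) (q i))})"
    unfolding AB by (simp add: PiE_Int)
  then show "A \<inter> B \<in> rational_boxes k" by (auto simp: rational_boxes_def)
qed

text \<open>
  Letting the slopes grow turns products of ramps into indicators of rational boxes in the past
  coordinates. These boxes form an intersection-stable generator, so that the increment integrates to zero
  over every event of the past by Dynkin's argument; the whole space is almost surely a box because the coordinates
  are bounded.
\<close>

lemma martingale_measureI_ramp:
  assumes \<pi>: "prob_space \<pi>" "sets \<pi> = sets (Rn d)"
    and bdd: "\<And>i. i \<in> {1..d} \<Longrightarrow> AE x in \<pi>. \<bar>x i\<bar> \<le> R"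
    and orth: "\<And>k q n. k \<in> {1..<d} \<Longrightarrow>
      (\<integral>x. (\<Prod>i\<in>{1..k}. ramp (q i) n (x i)) * (x (Suc k) - x k) \<partial>\<pi>) = 0"
  shows "martingale_measure d \<pi>"
proof -
  interpret prob_space \<pi> by fact
  have m\<pi>: "(\<lambda>x. x i) \<in> borel_measurable \<pi>" if "i \<in> {1..d}" for i
    using coordinate_measurable_Rn[OF that] measurable_cong_sets[OF \<pi>(2) refl] by blast
  have int: "integrable \<pi> (\<lambda>x. x i)" if "i \<in> {1..d}" for i
    using bdd[OF that] m\<pi>[OF that] by (intro integrable_const_bound[where B = R]) auto
  have "AE x in \<pi>. real_cond_exp \<pi> (coord_algebra \<pi> k) (\<lambda>x. x (Suc k)) x = x k" if k: "k \<in> {1..<d}" for k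
  proof -
    let ?F = "coord_algebra \<pi> k" and ?r = "\<lambda>x::nat \<Rightarrow> real. restrict x {1..k}"
    define \<Delta> where "\<Delta> x = x (Suc k) - x k" for x :: "nat \<Rightarrow> real"
    have kk: "Suc k \<in> {1..d}" "k \<in> {1..d}" "k \<le> d" "k \<in> {1..k}" "\<And>i. i \<in> {1..k} \<Longrightarrow> i \<in> {1..d}" using k by auto
    interpret finite_measure_subalgebra \<pi> ?F
      using coord_algebra_subalgebra[OF \<pi>(2) kk(3)] by unfold_locales
    have \<Delta>_int: "integrable \<pi> \<Delta>" unfolding \<Delta>_def using int kk by auto
    have \<Delta>_bd: "AE x in \<pi>. \<bar>\<Delta> x\<bar> \<le> 2 * R"
      using bdd[OF kk(1)] bdd[OF kk(2)] by eventually_elim (auto simp: \<Delta>_def)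
    have r_m: "?r \<in> measurable \<pi> (Rn k)"
      using measurable_restrict_Rn[OF kk(3)] measurable_cong_sets[OF \<pi>(2) refl] by blast
    define V where "V B = ?r -` B \<inter> space \<pi>" for B
    have V_sets: "V B \<in> sets \<pi>" if "B \<in> sets (Rn k)" for B
      unfolding V_def by (rule measurable_sets[OF r_m that])
    define PP where "PP B \<longleftrightarrow> (LINT x:V B|\<pi>. \<Delta> x) = 0" for B
    have box: "PP (PiE {1..k} (\<lambda>i. {..of_rat (q i)}))" for q :: "nat \<Rightarrow> rat"
    proof -
      let ?I = "\<lambda>x. \<Prod>i\<in>{1..k}. indicator {..of_rat (q i)} (x i) :: real"
      have I_m: "?I \<in> borel_measurable \<pi>"
        by (rule borel_measurable_prod, rule measurable_compose[OF m\<pi>[OF kk(5)]]) auto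
      have ramp_m: "(\<lambda>x. \<Prod>i\<in>{1..k}. ramp (q i) n (x i)) \<in> borel_measurable \<pi>" for n
        by (rule borel_measurable_prod, rule measurable_compose[OF m\<pi>[OF kk(5)]]) auto
      have "(\<lambda>n. \<integral>x. (\<Prod>i\<in>{1..k}. ramp (q i) n (x i)) * \<Delta> x \<partial>\<pi>) \<longlonglongrightarrow> (\<integral>x. ?I x * \<Delta> x \<partial>\<pi>)"
      proof (rule integral_dominated_convergence[where w = "\<lambda>_. 2 * R"])
        show "(\<lambda>x. ?I x * \<Delta> x) \<in> borel_measurable \<pi>"
          by (rule borel_measurable_times[OF I_m borel_measurable_integrable[OF \<Delta>_int]])
        show "(\<lambda>x. (\<Prod>i\<in>{1..k}. ramp (q i) n (x i)) * \<Delta> x) \<in> borel_measurable \<pi>" for n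
          by (rule borel_measurable_times[OF ramp_m borel_measurable_integrable[OF \<Delta>_int]])
        show "AE x in \<pi>. (\<lambda>n. (\<Prod>i\<in>{1..k}. ramp (q i) n (x i)) * \<Delta> x) \<longlonglongrightarrow> ?I x * \<Delta> x"
          by (intro AE_I2 tendsto_mult tendsto_const tendsto_prod ramp_tendsto_indicator)
        show "AE x in \<pi>. norm ((\<Prod>i\<in>{1..k}. ramp (q i) n (x i)) * \<Delta> x) \<le> 2 * R" for n
          using \<Delta>_bd
        proof eventually_elim
          fix x assume "\<bar>\<Delta> x\<bar> \<le> 2 * R"
          moreover have "0 \<le> (\<Prod>i\<in>{1..k}. ramp (q i) n (x i))" "(\<Prod>i\<in>{1..k}. ramp (q i) n (x i)) \<le> 1"
            using ramp_bounds by (auto intro: prod_nonneg prod_le_1)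
          ultimately have "\<bar>\<Prod>i\<in>{1..k}. ramp (q i) n (x i)\<bar> * \<bar>\<Delta> x\<bar> \<le> 1 * (2 * R)"
            by (intro mult_mono) auto
          then show "norm ((\<Prod>i\<in>{1..k}. ramp (q i) n (x i)) * \<Delta> x) \<le> 2 * R" by (simp add: abs_mult)
        qed
      qed auto
      then have "(\<integral>x. ?I x * \<Delta> x \<partial>\<pi>) = 0"
        using orth[OF k] by (simp add: \<Delta>_def LIMSEQ_const_iff)
      moreover have "(\<integral>x. ?I x * \<Delta> x \<partial>\<pi>) = (LINT x:V (PiE {1..k} (\<lambda>i. {..of_rat (q i)}))|\<pi>. \<Delta> x)"
        unfolding set_lebesgue_integral_def
      proof (rule Bochner_Integration.integral_cong[OF refl])
        fix x assume "x \<in> space \<pi>"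
        then have "indicator (V (PiE {1..k} (\<lambda>i. {..of_rat (q i)}))) x = ?I x"
          by (auto simp: V_def indicator_def PiE_iff prod_zero_iff)
        then show "?I x * \<Delta> x = indicator (V (PiE {1..k} (\<lambda>i. {..of_rat (q i)}))) x *\<^sub>R \<Delta> x" by simp
      qed
      ultimately show ?thesis by (simp add: PP_def)
    qed
    have total: "(\<integral>x. \<Delta> x \<partial>\<pi>) = 0"
    proof -
      obtain N :: nat where N: "R \<le> real N" using real_arch_simple by blast
      \<comment> \<open>A box that contains almost every point, with a rational corner.\<close>
      let ?B = "PiE {1..k} (\<lambda>_. {..real_of_rat (of_nat N)})"
      have all: "AE x in \<pi>. \<forall>i\<in>{1..k}. \<bar>x i\<bar> \<le> R"
        using bdd kk(5) by (intro AE_finite_allI) auto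
      have "(\<integral>x. \<Delta> x \<partial>\<pi>) = (LINT x:V ?B|\<pi>. \<Delta> x)"
        unfolding set_lebesgue_integral_def
      proof (rule integral_cong_AE)
        have "?B \<in> sets (Rn k)" 
          unfolding sets_Rn_eq_rational_boxes rational_boxes_def
          by (intro sigma_sets.Basic range_eqI[of _ _ "\<lambda>_. of_nat N"]) simp
        then show "(\<lambda>x. indicator (V ?B) x *\<^sub>R \<Delta> x) \<in> borel_measurable \<pi>"
          using V_sets \<Delta>_int by (intro borel_measurable_scaleR borel_measurable_indicator) auto
        show "AE x in \<pi>. \<Delta> x = indicator (V ?B) x *\<^sub>R \<Delta> x"
          using all AE_space
        proof eventually_elim
          fix x assume x: "\<forall>i\<in>{1..k}. \<bar>x i\<bar> \<le> R" "x \<in> space \<pi>"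
          then have "\<forall>i\<in>{1..k}. x i \<le> real N" using N by force
          then have "x \<in> V ?B" using x(2) by (auto simp: V_def)
          then show "\<Delta> x = indicator (V ?B) x *\<^sub>R \<Delta> x" by simp
        qed
      qed (use \<Delta>_int in auto)
      then show ?thesis using box[of "\<lambda>_. of_nat N"] by (simp add: PP_def)
    qed
    have PP: "PP B" if B: "B \<in> sets (Rn k)" for B
    proof -
      have sub: "rational_boxes k \<subseteq> Pow (PiE {1..k} (\<lambda>_. UNIV))" by (auto simp: rational_boxes_def PiE_iff)
      show ?thesis
        using Int_stable_rational_boxes[of k] sub B[unfolded sets_Rn_eq_rational_boxes]
      proof (induction rule: sigma_sets_induct_disjoint)
      case (basic A) then show ?case using box by (auto simp: rational_boxes_def)
    next
      case empty show ?case by (simp add: PP_def V_def set_lebesgue_integral_def)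
    next
      case (compl A)
      have A: "V A \<in> sets \<pi>" using compl(1) by (intro V_sets) (simp add: sets_Rn_eq_rational_boxes)
      have "(LINT x:V (PiE {1..k} (\<lambda>_. UNIV) - A)|\<pi>. \<Delta> x) = (\<integral>x. \<Delta> x - indicator (V A) x *\<^sub>R \<Delta> x \<partial>\<pi>)"
        unfolding set_lebesgue_integral_def
        by (rule Bochner_Integration.integral_cong[OF refl]) (auto simp: V_def indicator_def)
      also have "\<dots> = (\<integral>x. \<Delta> x \<partial>\<pi>) - (LINT x:V A|\<pi>. \<Delta> x)"
        unfolding set_lebesgue_integral_def
        by (rule Bochner_Integration.integral_diff[OF \<Delta>_int integrable_mult_indicator[OF A \<Delta>_int]])
      finally show ?case using total compl by (simp add: PP_def)
    next
      case (union A)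
      have A: "V (A i) \<in> sets \<pi>" for i
        using union(2) by (intro V_sets) (auto simp: sets_Rn_eq_rational_boxes)
      have "V (\<Union>i. A i) = (\<Union>i. V (A i))" by (auto simp: V_def)
      moreover have "(LINT x:(\<Union>i. V (A i))|\<pi>. \<Delta> x) = (\<Sum>i. LINT x:V (A i)|\<pi>. \<Delta> x)"
      proof (rule lebesgue_integral_countable_add[OF A])
        show "V (A i) \<inter> V (A j) = {}" if "i \<noteq> j" for i j
          using union(1) that by (auto simp: V_def disjoint_family_on_def)
        show "set_integrable \<pi> (\<Union>i. V (A i)) \<Delta>"
          unfolding set_integrable_def using A by (intro integrable_mult_indicator \<Delta>_int) auto
      qed
      ultimately show ?case using union(3) by (simp add: PP_def)
      qed
    qed
    show ?thesis
    proof (rule real_cond_exp_charact)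
      fix A assume "A \<in> sets ?F"
      then obtain B where B: "B \<in> sets (Rn k)" "A = V B"
        unfolding coord_algebra_def V_def using restrict_into_space_Rn by (auto simp: sets_vimage_algebra2)
      have A: "A \<in> sets \<pi>" using B V_sets by simp
      have si: "set_integrable \<pi> A (\<lambda>x. x i)" if "i \<in> {1..d}" for i
        unfolding set_integrable_def by (rule integrable_mult_indicator[OF A int[OF that]])
      have "(LINT x:A|\<pi>. \<Delta> x) = (LINT x:A|\<pi>. x (Suc k)) - (LINT x:A|\<pi>. x k)"
        unfolding \<Delta>_def by (rule set_integral_diff(2)[OF si[OF kk(1)] si[OF kk(2)]])
      then show "(LINT x:A|\<pi>. x (Suc k)) = (LINT x:A|\<pi>. x k)" using PP[OF B(1)] B(2) by (simp add: PP_def)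
    next
      show "(\<lambda>x. x k) \<in> borel_measurable ?F"
        using coord_algebra_measurable[OF coordinate_measurable_Rn[OF kk(4)] restrict_into_space_Rn, of \<pi>] kk(4)
        by simp
    qed (use int kk in auto)
  qed
  then show ?thesis using \<pi> int by (auto simp: martingale_measure_def prob_Rn_def)
qed

section \<open>Lagrangians on the compactified space\<close>

text \<open>
  In the coordinate \<open>u = arctan x\<close> this is the projection of \<open>x\<close> to \<open>{- N..N}\<close>. Written
  in terms of \<open>u\<close>, it stays continuous at the two points at infinity \<open>u = - pi / 2\<close> and
  \<open>u = pi / 2\<close>, where \<open>tan\<close> does not.
\<close>

definition clip_tan :: "real \<Rightarrow> real \<Rightarrow> real" where
  "clip_tan N u = tan (max (- arctan N) (min (arctan N) u))"

lemma clip_tan_arctan: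
  assumes "N \<ge> 0" shows "clip_tan N (arctan x) = max (- N) (min N x)"
proof -
  have "max (- arctan N) (min (arctan N) (arctan x)) = arctan (max (- N) (min N x))"
    by (auto simp: max_def min_def arctan_le_iff arctan_minus[symmetric])
  then show ?thesis by (simp add: clip_tan_def tan_arctan)
qed

lemma continuous_clip_tan:
  assumes "N \<ge> 0" shows "continuous_on UNIV (clip_tan N)"
proof -
  have "cos (max (- arctan N) (min (arctan N) u)) \<noteq> 0" for u
  proof -
    have "- (pi / 2) < max (- arctan N) (min (arctan N) u)" "max (- arctan N) (min (arctan N) u) < pi / 2"
      using arctan_bounded[of N] assms by (auto simp: max_def min_def)
    from cos_gt_zero_pi[OF this] show ?thesis by simp
  qed
  then show ?thesis unfolding clip_tan_def by (intro continuous_on_tan continuous_intros) auto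
qed

text \<open>
  The left-hand side of the dual constraint, with a variable objective \<open>g\<close>: scaling the objective makes the
  expression jointly homogeneous in objective and multipliers.
\<close>

definition lagrangian ::
    "nat \<Rightarrow> ((nat \<Rightarrow> real) \<Rightarrow> real) \<Rightarrow> real \<Rightarrow> real \<Rightarrow> (nat \<Rightarrow> (nat \<Rightarrow> real) \<Rightarrow> real) \<Rightarrow>
     (nat \<Rightarrow> real \<Rightarrow> real) \<Rightarrow> (nat \<Rightarrow> real) \<Rightarrow> (nat \<Rightarrow> real) \<Rightarrow> real" where
  "lagrangian d g \<gamma> \<eta> \<alpha> \<beta> x x' =
     g x' + (\<Sum>k\<in>{1..d - 1}. \<alpha> k (restrict x' {1..k}) * (x' (Suc k) - x' k))
       - \<gamma> * l1_dist d x x' - (\<Sum>k\<in>{1..d}. \<beta> k (x k)) + \<eta> * x' 1"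

definition multipliers ::
    "nat \<Rightarrow> (nat \<Rightarrow> real set) \<Rightarrow>
     (real \<times> real \<times> (nat \<Rightarrow> (nat \<Rightarrow> real) \<Rightarrow> real) \<times> (nat \<Rightarrow> real \<Rightarrow> real)) set" where
  "multipliers d \<Lambda> = {(\<gamma>, \<eta>, \<alpha>, \<beta>). \<gamma> \<ge> 0 \<and>
     (\<forall>k\<in>{1..d - 1}. continuous_on (PiE {1..k} \<Lambda>) (\<alpha> k)) \<and>
     (\<forall>k\<in>{1..d}. continuous_on UNIV (\<beta> k) \<and> bounded (range (\<beta> k)))}"

lemma dual_feasible_iff:
  "(\<gamma>, \<eta>, \<alpha>, \<beta>) \<in> dual_feasible d g \<Lambda> \<longleftrightarrow> (\<gamma>, \<eta>, \<alpha>, \<beta>) \<in> multipliers d \<Lambda> \<and>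
     (\<forall>x\<in>PiE {1..d} (\<lambda>_. UNIV). \<forall>x'\<in>PiE {1..d} \<Lambda>. lagrangian d g \<gamma> \<eta> \<alpha> \<beta> x x' \<le> 0)"
  by (auto simp: dual_feasible_def multipliers_def lagrangian_def)

definition multiplier_cost ::
    "nat \<Rightarrow> (nat \<Rightarrow> real measure) \<Rightarrow> real \<Rightarrow> real \<Rightarrow> (nat \<Rightarrow> real \<Rightarrow> real) \<Rightarrow> real" where
  "multiplier_cost d \<nu> \<epsilon> \<gamma> \<beta> = \<gamma> * \<epsilon> + (\<Sum>k\<in>{1..d}. \<integral>x. \<beta> k x \<partial>\<nu> k)"

lemma multipliers_bounded:
  assumes "(\<gamma>, \<eta>, \<alpha>, \<beta>) \<in> multipliers d \<Lambda>" "k \<in> {1..d}"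
  shows "\<exists>B. \<forall>x. \<bar>\<beta> k x\<bar> \<le> B"
proof -
  have "bounded (range (\<beta> k))" using assms by (simp add: multipliers_def)
  then show ?thesis by (auto simp: bounded_iff)
qed

lemma multipliers_cone:
  assumes "(\<gamma>, \<eta>, \<alpha>, \<beta>) \<in> multipliers d \<Lambda>" "(\<gamma>', \<eta>', \<alpha>', \<beta>') \<in> multipliers d \<Lambda>" "s \<ge> 0" "t \<ge> 0"
  shows "(s * \<gamma> + t * \<gamma>', s * \<eta> + t * \<eta>', \<lambda>k y. s * \<alpha> k y + t * \<alpha>' k y, \<lambda>k x. s * \<beta> k x + t * \<beta>' k x)
    \<in> multipliers d \<Lambda>"
proof -
  have "bounded (range (\<lambda>x. s * \<beta> k x + t * \<beta>' k x))" if k: "k \<in> {1..d}" for k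
  proof -
    obtain B B' where "\<And>x. \<bar>\<beta> k x\<bar> \<le> B" "\<And>x. \<bar>\<beta>' k x\<bar> \<le> B'"
      using multipliers_bounded[OF assms(1) k] multipliers_bounded[OF assms(2) k] by blast
    then have "\<bar>s * \<beta> k x + t * \<beta>' k x\<bar> \<le> s * B + t * B'" for x
      using assms(3,4)
      by (intro order_trans[OF abs_triangle_ineq] add_mono) (auto simp: abs_mult intro!: mult_left_mono)
    then show ?thesis by (auto simp: bounded_iff)
  qed
  then show ?thesis using assms by (auto simp: multipliers_def intro!: continuous_intros)
qed

lemma multipliers_integrable:
  assumes "(\<gamma>, \<eta>, \<alpha>, \<beta>) \<in> multipliers d \<Lambda>" "k \<in> {1..d}" "prob_space N" "sets N = sets borel"
  shows "integrable N (\<beta> k)"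
proof -
  interpret prob_space N by fact
  have c: "continuous_on UNIV (\<beta> k)" using assms(1,2) by (auto simp: multipliers_def)
  obtain B where "\<And>x. \<bar>\<beta> k x\<bar> \<le> B" using multipliers_bounded[OF assms(1,2)] by blast
  moreover have "\<beta> k \<in> borel_measurable N"
    unfolding measurable_cong_sets[OF assms(4) refl] by (rule borel_measurable_continuous_onI[OF c])
  ultimately show ?thesis by (intro integrable_const_bound[where B = B]) auto
qed

lemma lagrangian_cone:
  "lagrangian d (\<lambda>x. s * g x + t * g' x) (s * \<gamma> + t * \<gamma>') (s * \<eta> + t * \<eta>')
     (\<lambda>k y. s * \<alpha> k y + t * \<alpha>' k y) (\<lambda>k x. s * \<beta> k x + t * \<beta>' k x) x x'
   = s * lagrangian d g \<gamma> \<eta> \<alpha> \<beta> x x' + t * lagrangian d g' \<gamma>' \<eta>' \<alpha>' \<beta>' x x'"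
proof -
  have "(\<Sum>k\<in>{1..d - 1}. (s * \<alpha> k (restrict x' {1..k}) + t * \<alpha>' k (restrict x' {1..k})) * (x' (Suc k) - x' k))
    = s * (\<Sum>k\<in>{1..d - 1}. \<alpha> k (restrict x' {1..k}) * (x' (Suc k) - x' k))
      + t * (\<Sum>k\<in>{1..d - 1}. \<alpha>' k (restrict x' {1..k}) * (x' (Suc k) - x' k))"
    by (simp only: distrib_right sum.distrib sum_distrib_left mult.assoc)
  moreover have "(\<Sum>k\<in>{1..d}. s * \<beta> k (x k) + t * \<beta>' k (x k))
    = s * (\<Sum>k\<in>{1..d}. \<beta> k (x k)) + t * (\<Sum>k\<in>{1..d}. \<beta>' k (x k))"
    by (simp only: sum.distrib sum_distrib_left)
  ultimately show ?thesis unfolding lagrangian_def by (simp only: ) (simp add: algebra_simps)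
qed

text \<open>
  Coordinates \<open>1..d\<close> carry the martingale point \<open>x'\<close>, coordinates \<open>d + 1..2 * d\<close> the
  compactified point \<open>x\<close> of the reference marginals.
\<close>

definition joint :: "nat \<Rightarrow> (nat \<Rightarrow> real) \<Rightarrow> (nat \<Rightarrow> real) \<Rightarrow> nat \<Rightarrow> real" where
  "joint d x x' = (\<lambda>i\<in>{1..2 * d}. if i \<le> d then x' i else arctan (x (i - d)))"

definition compactified :: "nat \<Rightarrow> (nat \<Rightarrow> real set) \<Rightarrow> (nat \<Rightarrow> real) set" where
  "compactified d \<Lambda> = PiE {1..2 * d} (\<lambda>i. if i \<le> d then \<Lambda> i else {- (pi / 2)..pi / 2})"

lemma compact_compactified:
  assumes "\<And>i. i \<in> {1..d} \<Longrightarrow> compact (\<Lambda> i)" shows "compact (compactified d \<Lambda>)"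
  unfolding compactified_def using assms by (intro compact_PiE) auto

lemma joint_in_compactified:
  assumes "x' \<in> PiE {1..d} \<Lambda>" shows "joint d x x' \<in> compactified d \<Lambda>"
  unfolding compactified_def
proof (rule PiE_I)
  fix i assume "i \<in> {1..2 * d}"
  then show "joint d x x' i \<in> (if i \<le> d then \<Lambda> i else {- (pi / 2)..pi / 2})"
    using PiE_mem[OF assms, of i] arctan_bounded[of "x (i - d)"] by (cases "i \<le> d") (auto simp: joint_def)
next
  fix i assume "i \<notin> {1..2 * d}"
  then show "joint d x x' i = undefined" unfolding joint_def by (simp only: restrict_def if_False)
qed

lemma joint_simps:
  assumes "k \<in> {1..d}" shows "joint d x x' k = x' k" "joint d x x' (d + k) = arctan (x k)"
  using assms by (auto simp: joint_def)

lemma restrict_joint: "x' \<in> PiE {1..d} S \<Longrightarrow> restrict (joint d x x') {1..d} = x'"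
proof (rule ext)
  fix i assume "x' \<in> PiE {1..d} S"
  then show "restrict (joint d x x') {1..d} i = x' i"
    using PiE_arb[of x' "{1..d}" S i] by (cases "i \<in> {1..d}") (auto simp: joint_simps)
qed

text \<open>
  Functions in this cone have a nonnegative integral, by the argument for weak duality, under every joint law
  that is admissible for the primal problem and has objective at least \<open>v\<close>. The weight \<open>a\<close> of the
  objective may vanish.
\<close>

definition dominating ::
    "nat \<Rightarrow> ((nat \<Rightarrow> real) \<Rightarrow> real) \<Rightarrow> (nat \<Rightarrow> real set) \<Rightarrow> (nat \<Rightarrow> real measure) \<Rightarrow> real \<Rightarrow> real \<Rightarrow>
     ((nat \<Rightarrow> real) \<Rightarrow> real) set" where
  "dominating d f \<Lambda> \<nu> \<epsilon> v = {h. \<exists>a \<gamma> \<eta> \<alpha> \<beta>. a \<ge> 0 \<and> (\<gamma>, \<eta>, \<alpha>, \<beta>) \<in> multipliers d \<Lambda> \<and>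
     (\<forall>x\<in>PiE {1..d} (\<lambda>_. UNIV). \<forall>x'\<in>PiE {1..d} \<Lambda>.
        lagrangian d (\<lambda>x. a * f x) \<gamma> \<eta> \<alpha> \<beta> x x' + multiplier_cost d \<nu> \<epsilon> \<gamma> \<beta> - a * v \<le> h (joint d x x'))}"

lemma dominatingI:
  assumes "a \<ge> 0" "(\<gamma>, \<eta>, \<alpha>, \<beta>) \<in> multipliers d \<Lambda>"
    "\<And>x x'. x \<in> PiE {1..d} (\<lambda>_. UNIV) \<Longrightarrow> x' \<in> PiE {1..d} \<Lambda> \<Longrightarrow>
       lagrangian d (\<lambda>x. a * f x) \<gamma> \<eta> \<alpha> \<beta> x x' + multiplier_cost d \<nu> \<epsilon> \<gamma> \<beta> - a * v \<le> h (joint d x x')"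
  shows "h \<in> dominating d f \<Lambda> \<nu> \<epsilon> v"
  unfolding dominating_def mem_Collect_eq using assms by (intro exI conjI ballI)

lemma dominatingE:
  assumes "h \<in> dominating d f \<Lambda> \<nu> \<epsilon> v"
  obtains a \<gamma> \<eta> \<alpha> \<beta> where "a \<ge> 0" "(\<gamma>, \<eta>, \<alpha>, \<beta>) \<in> multipliers d \<Lambda>"
    "\<forall>x\<in>PiE {1..d} (\<lambda>_. UNIV). \<forall>x'\<in>PiE {1..d} \<Lambda>.
       lagrangian d (\<lambda>x. a * f x) \<gamma> \<eta> \<alpha> \<beta> x x' + multiplier_cost d \<nu> \<epsilon> \<gamma> \<beta> - a * v \<le> h (joint d x x')"
  using assms unfolding dominating_def mem_Collect_eq by (elim exE conjE) (rule that)

lemma dominating_cone: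
  assumes \<nu>: "\<And>i. i \<in> {1..d} \<Longrightarrow> prob_space (\<nu> i)" "\<And>i. i \<in> {1..d} \<Longrightarrow> sets (\<nu> i) = sets borel"
    and h: "h \<in> dominating d f \<Lambda> \<nu> \<epsilon> v" and h': "h' \<in> dominating d f \<Lambda> \<nu> \<epsilon> v" and st: "s \<ge> 0" "t \<ge> 0"
  shows "(\<lambda>\<omega>. s * h \<omega> + t * h' \<omega>) \<in> dominating d f \<Lambda> \<nu> \<epsilon> v"
proof -
  obtain a \<gamma> \<eta> \<alpha> \<beta> where 1: "a \<ge> 0" "(\<gamma>, \<eta>, \<alpha>, \<beta>) \<in> multipliers d \<Lambda>"
    "\<forall>x\<in>PiE {1..d} (\<lambda>_. UNIV). \<forall>x'\<in>PiE {1..d} \<Lambda>.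
       lagrangian d (\<lambda>x. a * f x) \<gamma> \<eta> \<alpha> \<beta> x x' + multiplier_cost d \<nu> \<epsilon> \<gamma> \<beta> - a * v \<le> h (joint d x x')"
    by (rule dominatingE[OF h])
  obtain a' \<gamma>' \<eta>' \<alpha>' \<beta>' where 2: "a' \<ge> 0" "(\<gamma>', \<eta>', \<alpha>', \<beta>') \<in> multipliers d \<Lambda>"
    "\<forall>x\<in>PiE {1..d} (\<lambda>_. UNIV). \<forall>x'\<in>PiE {1..d} \<Lambda>.
       lagrangian d (\<lambda>x. a' * f x) \<gamma>' \<eta>' \<alpha>' \<beta>' x x' + multiplier_cost d \<nu> \<epsilon> \<gamma>' \<beta>' - a' * v \<le> h' (joint d x x')"
    by (rule dominatingE[OF h'])
  have "(\<integral>x. s * \<beta> k x + t * \<beta>' k x \<partial>\<nu> k) = s * (\<integral>x. \<beta> k x \<partial>\<nu> k) + t * (\<integral>x. \<beta>' k x \<partial>\<nu> k)"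
    if "k \<in> {1..d}" for k
    using multipliers_integrable[OF 1(2) that \<nu>[OF that]] multipliers_integrable[OF 2(2) that \<nu>[OF that]] by simp
  then have "(\<Sum>k\<in>{1..d}. \<integral>x. s * \<beta> k x + t * \<beta>' k x \<partial>\<nu> k)
      = (\<Sum>k\<in>{1..d}. s * (\<integral>x. \<beta> k x \<partial>\<nu> k) + t * (\<integral>x. \<beta>' k x \<partial>\<nu> k))"
    by (rule sum.cong[OF refl])
  also have "\<dots> = s * (\<Sum>k\<in>{1..d}. \<integral>x. \<beta> k x \<partial>\<nu> k) + t * (\<Sum>k\<in>{1..d}. \<integral>x. \<beta>' k x \<partial>\<nu> k)"
    by (simp only: sum.distrib sum_distrib_left)
  finally have sum: "(\<Sum>k\<in>{1..d}. \<integral>x. s * \<beta> k x + t * \<beta>' k x \<partial>\<nu> k)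
      = s * (\<Sum>k\<in>{1..d}. \<integral>x. \<beta> k x \<partial>\<nu> k) + t * (\<Sum>k\<in>{1..d}. \<integral>x. \<beta>' k x \<partial>\<nu> k)" .
  have cost: "multiplier_cost d \<nu> \<epsilon> (s * \<gamma> + t * \<gamma>') (\<lambda>k x. s * \<beta> k x + t * \<beta>' k x)
      = s * multiplier_cost d \<nu> \<epsilon> \<gamma> \<beta> + t * multiplier_cost d \<nu> \<epsilon> \<gamma>' \<beta>'"
    unfolding multiplier_cost_def sum by (simp only: distrib_left distrib_right mult.assoc add_ac)
  show ?thesis
  proof (rule dominatingI[OF _ multipliers_cone[OF 1(2) 2(2) st]])
    show "0 \<le> s * a + t * a'" using st 1(1) 2(1) by simp
    fix x x' assume x: "x \<in> PiE {1..d} (\<lambda>_. UNIV :: real set)" and x': "x' \<in> PiE {1..d} \<Lambda>"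
    have "(\<lambda>x. (s * a + t * a') * f x) = (\<lambda>x. s * (a * f x) + t * (a' * f x))" by (simp add: algebra_simps)
    note eq = this
    have arith: "s * L + t * L' + (s * C + t * C') - (s * a + t * a') * v
        = s * (L + C - a * v) + t * (L' + C' - a' * v)" for L L' C C'
      by (simp add: algebra_simps)
    show "lagrangian d (\<lambda>x. (s * a + t * a') * f x) (s * \<gamma> + t * \<gamma>') (s * \<eta> + t * \<eta>')
         (\<lambda>k y. s * \<alpha> k y + t * \<alpha>' k y) (\<lambda>k x. s * \<beta> k x + t * \<beta>' k x) x x'
        + multiplier_cost d \<nu> \<epsilon> (s * \<gamma> + t * \<gamma>') (\<lambda>k x. s * \<beta> k x + t * \<beta>' k x)
        - (s * a + t * a') * v \<le> s * h (joint d x x') + t * h' (joint d x x')"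
      unfolding eq cost arith lagrangian_cone[of d s "\<lambda>x. a * f x" t "\<lambda>x. a' * f x"]
      by (rule add_mono[OF mult_left_mono[OF 1(3)[rule_format, OF x x'] st(1)] mult_left_mono[OF 2(3)[rule_format, OF x x'] st(2)]])
  qed
qed

lemma zero_multipliers: "(0, 0, \<lambda>_ _. 0, \<lambda>_ _. 0) \<in> multipliers d \<Lambda>"
  by (auto simp: multipliers_def)

lemma zero_dominating: "(\<lambda>_. 0) \<in> dominating d f \<Lambda> \<nu> \<epsilon> v"
  by (rule dominatingI[OF _ zero_multipliers, of 0]) (auto simp: lagrangian_def multiplier_cost_def)

lemma sum_dominating:
  assumes \<nu>: "\<And>i. i \<in> {1..d} \<Longrightarrow> prob_space (\<nu> i)" "\<And>i. i \<in> {1..d} \<Longrightarrow> sets (\<nu> i) = sets borel"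
    and "finite F" "F \<subseteq> dominating d f \<Lambda> \<nu> \<epsilon> v" "\<And>h. c h \<ge> 0"
  shows "(\<lambda>\<omega>. \<Sum>h\<in>F. c h * h \<omega>) \<in> dominating d f \<Lambda> \<nu> \<epsilon> v"
  using assms(3,4)
proof (induction F rule: finite_induct)
  case empty show ?case by (simp add: zero_dominating)
next
  case (insert h F)
  have "(\<lambda>\<omega>. c h * h \<omega> + 1 * (\<Sum>h\<in>F. c h * h \<omega>)) \<in> dominating d f \<Lambda> \<nu> \<epsilon> v"
    using insert assms(5) by (intro dominating_cone \<nu>) auto
  then show ?case using insert by simp
qed

lemma dual_value_le:
  assumes "(\<gamma>, \<eta>, \<alpha>, \<beta>) \<in> dual_feasible d f \<Lambda>"
  shows "dual_value d f \<Lambda> \<nu> \<epsilon> \<le> ereal (multiplier_cost d \<nu> \<epsilon> \<gamma> \<beta>)"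
  unfolding dual_value_def multiplier_cost_def using assms by (intro INF_lower2[of "(\<gamma>, \<eta>, \<alpha>, \<beta>)"]) auto

text \<open>
  A uniformly negative function in the cone would either beat the dual value \<open>v\<close> after division by the weight \<open>a\<close>
  of the objective or, for \<open>a = 0\<close>, certify that the ball is empty.
\<close>

lemma dominating_not_negative:
  assumes "d \<ge> 1"
    and \<Lambda>: "\<And>i. i \<in> {1..d} \<Longrightarrow> compact (\<Lambda> i)"
    and \<nu>: "\<And>i. i \<in> {1..d} \<Longrightarrow> prob_space (\<nu> i)" "\<And>i. i \<in> {1..d} \<Longrightarrow> sets (\<nu> i) = sets borel"
    and "\<epsilon> \<ge> 0" and ball: "mart_ball_on d \<Lambda> \<nu> \<epsilon> \<noteq> {}"
    and v: "ereal v \<le> dual_value d f \<Lambda> \<nu> \<epsilon>"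
    and h: "h \<in> dominating d f \<Lambda> \<nu> \<epsilon> v" and "\<delta> > 0"
  shows "\<exists>\<omega>\<in>compactified d \<Lambda>. h \<omega> > - \<delta>"
proof (rule ccontr)
  assume "\<not> (\<exists>\<omega>\<in>compactified d \<Lambda>. h \<omega> > - \<delta>)"
  then have neg: "\<And>\<omega>. \<omega> \<in> compactified d \<Lambda> \<Longrightarrow> h \<omega> \<le> - \<delta>" by force
  obtain a \<gamma> \<eta> \<alpha> \<beta> where a: "a \<ge> 0" and m: "(\<gamma>, \<eta>, \<alpha>, \<beta>) \<in> multipliers d \<Lambda>"
    and le: "\<forall>x\<in>PiE {1..d} (\<lambda>_. UNIV). \<forall>x'\<in>PiE {1..d} \<Lambda>.
       lagrangian d (\<lambda>x. a * f x) \<gamma> \<eta> \<alpha> \<beta> x x' + multiplier_cost d \<nu> \<epsilon> \<gamma> \<beta> - a * v \<le> h (joint d x x')"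
    by (rule dominatingE[OF h])
  \<comment> \<open>A constant moved into the first \<open>\<beta>\<close> makes the multipliers feasible for \<open>a * f\<close>.\<close>
  define \<kappa> where "\<kappa> = multiplier_cost d \<nu> \<epsilon> \<gamma> \<beta> - a * v + \<delta>"
  define \<beta>' where "\<beta>' k x = \<beta> k x - (if k = 1 then \<kappa> else 0)" for k x
  have m': "(\<gamma>, \<eta>, \<alpha>, \<beta>') \<in> multipliers d \<Lambda>"
  proof -
    have "(0, 0, \<lambda>_ _. 0, \<lambda>k x. if k = 1 then - \<kappa> else 0) \<in> multipliers d \<Lambda>"
      by (auto simp: multipliers_def)
    from multipliers_cone[OF m this, of 1 1] show ?thesis
      by (simp add: \<beta>'_def[abs_def] if_distrib[of uminus] diff_conv_add_uminus cong: if_cong)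
  qed
  have sum1: "(\<Sum>k\<in>{1..d}. if k = 1 then \<kappa> else 0) = \<kappa>" using \<open>d \<ge> 1\<close> by (simp add: sum.delta)
  have "(\<integral>x. \<beta>' k x \<partial>\<nu> k) = (\<integral>x. \<beta> k x \<partial>\<nu> k) - (if k = 1 then \<kappa> else 0)" if k: "k \<in> {1..d}" for k
  proof -
    interpret prob_space "\<nu> k" by (rule \<nu>[OF k])
    show ?thesis using multipliers_integrable[OF m k \<nu>[OF k]] by (simp add: \<beta>'_def prob_space)
  qed
  then have cost: "multiplier_cost d \<nu> \<epsilon> \<gamma> \<beta>' = a * v - \<delta>"
    by (simp add: multiplier_cost_def sum_subtractf sum1[simplified] \<kappa>_def)
  have lag: "lagrangian d (\<lambda>x. a * f x) \<gamma> \<eta> \<alpha> \<beta>' x x' \<le> 0"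
    if x: "x \<in> PiE {1..d} (\<lambda>_. UNIV)" and x': "x' \<in> PiE {1..d} \<Lambda>" for x x'
  proof -
    have "lagrangian d (\<lambda>x. a * f x) \<gamma> \<eta> \<alpha> \<beta>' x x' = lagrangian d (\<lambda>x. a * f x) \<gamma> \<eta> \<alpha> \<beta> x x' + \<kappa>"
      by (simp add: lagrangian_def \<beta>'_def sum_subtractf sum1[simplified])
    also have "\<dots> \<le> 0" using le[rule_format, OF x x'] neg[OF joint_in_compactified[OF x', of x]] by (simp add: \<kappa>_def)
    finally show ?thesis .
  qed
  show False
  proof (cases "a = 0")
    case True
    obtain \<pi> where \<pi>: "\<pi> \<in> mart_ball_on d \<Lambda> \<nu> \<epsilon>" using ball by auto
    have "(\<gamma>, \<eta>, \<alpha>, \<beta>') \<in> dual_feasible d (\<lambda>_. 0) \<Lambda>"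
      using m' lag True by (simp add: dual_feasible_iff)
    from weak_duality[OF \<open>d \<ge> 1\<close> _ \<Lambda> \<nu> \<open>\<epsilon> \<ge> 0\<close> \<pi> this] have "0 \<le> multiplier_cost d \<nu> \<epsilon> \<gamma> \<beta>'"
      by (simp add: multiplier_cost_def)
    then show False using cost True \<open>\<delta> > 0\<close> by simp
  next
    case False
    then have a: "a > 0" using a by simp
    have eq: "lagrangian d f (\<gamma> / a) (\<eta> / a) (\<lambda>k y. \<alpha> k y / a) (\<lambda>k x. \<beta>' k x / a) x x'
        = lagrangian d (\<lambda>x. a * f x) \<gamma> \<eta> \<alpha> \<beta>' x x' / a" for x x'
      using lagrangian_cone[of d "1 / a" "\<lambda>x. a * f x" 0 "\<lambda>_. 0" \<gamma> 0 \<eta> 0 \<alpha> "\<lambda>_ _. 0" \<beta>' "\<lambda>_ _. 0" x x'] a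
      by simp
    have "(\<gamma> / a, \<eta> / a, \<lambda>k y. \<alpha> k y / a, \<lambda>k x. \<beta>' k x / a) \<in> dual_feasible d f \<Lambda>"
      unfolding dual_feasible_iff eq
      using multipliers_cone[OF m' zero_multipliers, of "1 / a" 0] lag a by (auto simp: divide_le_0_iff)
    from dual_value_le[OF this, of \<nu> \<epsilon>] have "ereal v \<le> ereal (multiplier_cost d \<nu> \<epsilon> (\<gamma> / a) (\<lambda>k x. \<beta>' k x / a))"
      using v by (rule order_trans[rotated])
    moreover have "multiplier_cost d \<nu> \<epsilon> (\<gamma> / a) (\<lambda>k x. \<beta>' k x / a) = multiplier_cost d \<nu> \<epsilon> \<gamma> \<beta>' / a"
      by (simp add: multiplier_cost_def add_divide_distrib sum_divide_distrib)
    ultimately have "v \<le> (a * v - \<delta>) / a" by (simp add: cost)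
    then show False using a \<open>\<delta> > 0\<close> by (simp add: field_simps)
  qed
qed

lemma multipliersI:
  assumes "\<gamma> \<ge> 0" "\<And>k. k \<in> {1..d - 1} \<Longrightarrow> continuous_on UNIV (\<alpha> k)"
    "\<And>k. k \<in> {1..d} \<Longrightarrow> continuous_on UNIV (\<beta> k)" "\<And>k x. k \<in> {1..d} \<Longrightarrow> \<bar>\<beta> k x\<bar> \<le> B"
  shows "(\<gamma>, \<eta>, \<alpha>, \<beta>) \<in> multipliers d \<Lambda>"
proof -
  have "continuous_on (PiE {1..k} \<Lambda>) (\<alpha> k)" if "k \<in> {1..d - 1}" for k
    by (rule continuous_on_subset[OF assms(2)[OF that]]) simp
  moreover have "bounded (range (\<beta> k))" if "k \<in> {1..d}" for k
    using assms(4)[OF that] unfolding bounded_iff by (intro exI[of _ B]) auto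
  ultimately show ?thesis using assms(1,3) by (simp add: multipliers_def)
qed

lemma objective_dominating: "(\<lambda>\<omega>. f (restrict \<omega> {1..d}) - v) \<in> dominating d f \<Lambda> \<nu> \<epsilon> v"
  by (rule dominatingI[OF _ zero_multipliers, of 1])
    (simp_all add: lagrangian_def multiplier_cost_def restrict_joint del: One_nat_def)

lemma centering_dominating:
  assumes "d \<ge> 1" shows "(\<lambda>\<omega>. s * \<omega> 1) \<in> dominating d f \<Lambda> \<nu> \<epsilon> v"
proof (rule dominatingI[of 0 0 s "\<lambda>_ _. 0" "\<lambda>_ _. 0"])
  show "(0, s, \<lambda>_ _. 0, \<lambda>_ _. 0) \<in> multipliers d \<Lambda>" by (auto simp: multipliers_def)
qed (use assms in \<open>auto simp: lagrangian_def multiplier_cost_def joint_def\<close>)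

lemma continuous_coordinate: "continuous_on UNIV (\<lambda>y :: nat \<Rightarrow> real. y i)"
  by simp

lemma martingale_dominating:
  assumes k: "k \<in> {1..<d}"
  shows "(\<lambda>\<omega>. s * ((\<Prod>i\<in>{1..k}. ramp (q i) n (\<omega> i)) * (\<omega> (Suc k) - \<omega> k))) \<in> dominating d f \<Lambda> \<nu> \<epsilon> v"
proof -
  define \<alpha> where "\<alpha> j y = (if j = k then s * (\<Prod>i\<in>{1..k}. ramp (q i) n (y i)) else 0)"
    for j and y :: "nat \<Rightarrow> real"
  have "continuous_on UNIV (\<lambda>y :: nat \<Rightarrow> real. s * (\<Prod>i\<in>{1..k}. ramp (q i) n (y i)))"
    by (intro continuous_intros continuous_on_compose2[OF continuous_ramp continuous_coordinate]) auto
  then have \<alpha>: "continuous_on UNIV (\<alpha> j)" for j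
    by (cases "j = k") (auto simp: \<alpha>_def[abs_def])
  show ?thesis
  proof (rule dominatingI[of 0 0 0 \<alpha> "\<lambda>_ _. 0"])
    show "(0, 0, \<alpha>, \<lambda>_ _. 0) \<in> multipliers d \<Lambda>" by (rule multipliersI[where B = 0]) (auto simp: \<alpha>)
    fix x x' assume "x' \<in> PiE {1..d} \<Lambda>"
    let ?t = "s * ((\<Prod>i\<in>{1..k}. ramp (q i) n (x' i)) * (x' (Suc k) - x' k))"
    have "(\<Sum>j\<in>{1..d - 1}. \<alpha> j (restrict x' {1..j}) * (x' (Suc j) - x' j)) = (\<Sum>j\<in>{1..d - 1}. if j = k then ?t else 0)"
      by (intro sum.cong refl) (auto simp: \<alpha>_def)
    also have "\<dots> = ?t" using k by (subst sum.delta) auto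
    finally have "lagrangian d (\<lambda>x. 0 * f x) 0 0 \<alpha> (\<lambda>_ _. 0) x x' = ?t" by (simp add: lagrangian_def)
    moreover have "joint d x x' i = x' i" if "i \<in> {1..k}" for i using that k by (intro joint_simps) auto
    moreover have "joint d x x' (Suc k) = x' (Suc k)" "joint d x x' k = x' k" using k by (auto intro!: joint_simps)
    ultimately show "lagrangian d (\<lambda>x. 0 * f x) 0 0 \<alpha> (\<lambda>_ _. 0) x x' + multiplier_cost d \<nu> \<epsilon> 0 (\<lambda>_ _. 0) - 0 * v
       \<le> s * ((\<Prod>i\<in>{1..k}. ramp (q i) n (joint d x x' i)) * (joint d x x' (Suc k) - joint d x x' k))"
      by (simp add: multiplier_cost_def)
  qed simp
qed

lemma marginal_dominating:
  assumes k: "k \<in> {1..d}"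
  shows "(\<lambda>\<omega>. s * (ramp q n (\<omega> (d + k)) - (\<integral>x. ramp q n (arctan x) \<partial>\<nu> k))) \<in> dominating d f \<Lambda> \<nu> \<epsilon> v"
proof -
  define \<beta> where "\<beta> j x = (if j = k then - s * ramp q n (arctan x) else 0)" for j x
  have c: "continuous_on UNIV (\<lambda>x. ramp q n (arctan x))"
    by (rule continuous_on_compose2[OF continuous_ramp]) (auto intro: continuous_intros)
  show ?thesis
  proof (rule dominatingI[of 0 0 0 "\<lambda>_ _. 0" \<beta>])
    show "(0, 0, \<lambda>_ _. 0, \<beta>) \<in> multipliers d \<Lambda>"
    proof (rule multipliersI[where B = "\<bar>s\<bar>"])
      fix j show "continuous_on UNIV (\<beta> j)"
        by (cases "j = k") (auto simp: \<beta>_def[abs_def] intro!: continuous_intros c)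
      fix x show "\<bar>\<beta> j x\<bar> \<le> \<bar>s\<bar>"
        using ramp_bounds[of q n "arctan x"] by (auto simp: \<beta>_def abs_mult intro: mult_left_le)
    qed auto
    fix x x'
    have "(\<Sum>j\<in>{1..d}. \<beta> j (x j)) = (\<Sum>j\<in>{1..d}. if j = k then - s * ramp q n (arctan (x k)) else 0)"
      by (intro sum.cong) (auto simp: \<beta>_def)
    also have "\<dots> = - s * ramp q n (arctan (x k))" using k by (subst sum.delta) auto
    finally have 1: "(\<Sum>j\<in>{1..d}. \<beta> j (x j)) = - s * ramp q n (arctan (x k))" .
    have "(\<Sum>j\<in>{1..d}. \<integral>x. \<beta> j x \<partial>\<nu> j) = (\<Sum>j\<in>{1..d}. if j = k then - s * (\<integral>x. ramp q n (arctan x) \<partial>\<nu> k) else 0)"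
      by (intro sum.cong) (auto simp: \<beta>_def)
    also have "\<dots> = - s * (\<integral>x. ramp q n (arctan x) \<partial>\<nu> k)" using k by (subst sum.delta) auto
    finally have 2: "(\<Sum>j\<in>{1..d}. \<integral>x. \<beta> j x \<partial>\<nu> j) = - s * (\<integral>x. ramp q n (arctan x) \<partial>\<nu> k)" .
    show "lagrangian d (\<lambda>x. 0 * f x) 0 0 (\<lambda>_ _. 0) \<beta> x x' + multiplier_cost d \<nu> \<epsilon> 0 \<beta> - 0 * v
       \<le> s * (ramp q n (joint d x x' (d + k)) - (\<integral>x. ramp q n (arctan x) \<partial>\<nu> k))"
      unfolding lagrangian_def multiplier_cost_def 1 2 joint_simps[OF k] by (simp add: algebra_simps)
  qed simp
qed

text \<open>
  Projecting \<open>x\<close> to the cube of half-width \<open>N\<close>, which contains \<open>x'\<close>, does not increase the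
  distance to \<open>x'\<close>; so the continuous clipped cost is dominated by the true cost with \<open>\<gamma> = 1\<close>.
\<close>

lemma cost_dominating:
  assumes "N \<ge> 0" and \<Lambda>: "\<And>i x. i \<in> {1..d} \<Longrightarrow> x \<in> \<Lambda> i \<Longrightarrow> \<bar>x\<bar> \<le> N"
  shows "(\<lambda>\<omega>. \<epsilon> - (\<Sum>i\<in>{1..d}. \<bar>\<omega> i - clip_tan N (\<omega> (d + i))\<bar>)) \<in> dominating d f \<Lambda> \<nu> \<epsilon> v"
proof (rule dominatingI[of 0 1 0 "\<lambda>_ _. 0" "\<lambda>_ _. 0"])
  show "(1, 0, \<lambda>_ _. 0, \<lambda>_ _. 0) \<in> multipliers d \<Lambda>" by (auto simp: multipliers_def)
  fix x x' assume x': "x' \<in> PiE {1..d} \<Lambda>"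
  have "(\<Sum>i\<in>{1..d}. \<bar>joint d x x' i - clip_tan N (joint d x x' (d + i))\<bar>) \<le> (\<Sum>i\<in>{1..d}. \<bar>x i - x' i\<bar>)"
  proof (rule sum_mono)
    fix i assume i: "i \<in> {1..d}"
    have "\<bar>x' i\<bar> \<le> N" using \<Lambda>[OF i] x' i by (auto simp: PiE_iff)
    then have "\<bar>x' i - max (- N) (min N (x i))\<bar> \<le> \<bar>x i - x' i\<bar>" by (auto simp: max_def min_def)
    then show "\<bar>joint d x x' i - clip_tan N (joint d x x' (d + i))\<bar> \<le> \<bar>x i - x' i\<bar>"
      unfolding joint_simps[OF i] clip_tan_arctan[OF \<open>N \<ge> 0\<close>] .
  qed
  then show "lagrangian d (\<lambda>x. 0 * f x) 1 0 (\<lambda>_ _. 0) (\<lambda>_ _. 0) x x' + multiplier_cost d \<nu> \<epsilon> 1 (\<lambda>_ _. 0) - 0 * v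
     \<le> \<epsilon> - (\<Sum>i\<in>{1..d}. \<bar>joint d x x' i - clip_tan N (joint d x x' (d + i))\<bar>)"
    by (simp add: lagrangian_def multiplier_cost_def l1_dist_def)
qed simp

section \<open>From moments back to the martingale ball\<close>

lemma tan_measurable: "(tan :: real \<Rightarrow> real) \<in> borel_measurable borel"
proof -
  have "(\<lambda>x :: real. sin x / cos x) \<in> borel_measurable borel"
    by (intro borel_measurable_divide borel_measurable_continuous_onI continuous_intros)
  then show ?thesis by (simp add: tan_def[abs_def])
qed

lemma continuous_integrable_on_compact:
  fixes h :: "(nat \<Rightarrow> real) \<Rightarrow> real"
  assumes "prob_space M" "sets M = sets borel" "AE x in M. x \<in> K" "compact K" "continuous_on UNIV h"
  shows "integrable M h"
proof -
  interpret prob_space M by fact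
  have hK: "continuous_on K h" by (rule continuous_on_subset[OF assms(5)]) simp
  obtain B where "\<And>x. x \<in> K \<Longrightarrow> \<bar>h x\<bar> \<le> B"
    using continuous_on_compact_bounded[OF \<open>compact K\<close> hK] by metis
  then have "AE x in M. norm (h x) \<le> B" using assms(3) by auto
  moreover have "h \<in> borel_measurable M"
    unfolding measurable_cong_sets[OF assms(2) refl] by (rule borel_measurable_continuous_onI[OF assms(5)])
  ultimately show ?thesis by (rule integrable_const_bound)
qed

lemma clip_tan_eventually:
  assumes "- (pi / 2) < u" "u < pi / 2"
  shows "\<forall>\<^sub>F n in sequentially. clip_tan (R + real n) u = tan u"
proof -
  obtain m :: nat where m: "\<bar>tan u\<bar> + \<bar>R\<bar> \<le> real m" using real_arch_simple by blast
  have "clip_tan (R + real n) u = tan u" if "n \<ge> m" for n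
  proof -
    have n: "\<bar>tan u\<bar> \<le> R + real n" using m that by linarith
    then have "clip_tan (R + real n) (arctan (tan u)) = tan u"
      by (subst clip_tan_arctan) auto
    then show ?thesis using arctan_tan[OF assms] by simp
  qed
  then show ?thesis by (auto simp: eventually_sequentially)
qed

text \<open>
  The pair \<open>(x', tan u)\<close> is the required coupling. No mass sits at infinity, because the law of \<open>u k\<close> is
  the image of \<open>\<nu> k\<close> under \<open>arctan\<close>; hence the clipped costs converge almost surely to the true cost
  and Fatou's lemma bounds its mean by \<open>\<epsilon>\<close>.
\<close>

theorem primal_measure_of_moments:
  fixes f :: "(nat \<Rightarrow> real) \<Rightarrow> real"
  assumes "d \<ge> 1" and f: "continuous_on (PiE {1..d} (\<lambda>_. UNIV)) f"
    and \<Lambda>: "\<And>i. i \<in> {1..d} \<Longrightarrow> compact (\<Lambda> i)"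
    and R: "R \<ge> 0" "\<And>i x. i \<in> {1..d} \<Longrightarrow> x \<in> \<Lambda> i \<Longrightarrow> \<bar>x\<bar> \<le> R"
    and \<nu>: "\<And>i. i \<in> {1..d} \<Longrightarrow> prob_space (\<nu> i)" "\<And>i. i \<in> {1..d} \<Longrightarrow> sets (\<nu> i) = sets borel"
    and M: "prob_space M" "sets M = sets borel" "AE \<omega> in M. \<omega> \<in> compactified d \<Lambda>"
    and center: "(\<integral>\<omega>. \<omega> 1 \<partial>M) = 0"
    and orth: "\<And>k q n. k \<in> {1..<d} \<Longrightarrow>
      (\<integral>\<omega>. (\<Prod>i\<in>{1..k}. ramp (q i) n (\<omega> i)) * (\<omega> (Suc k) - \<omega> k) \<partial>M) = 0"
    and marg: "\<And>k q n. k \<in> {1..d} \<Longrightarrow> (\<integral>\<omega>. ramp q n (\<omega> (d + k)) \<partial>M) = (\<integral>x. ramp q n (arctan x) \<partial>\<nu> k)"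
    and cost: "\<And>n. (\<integral>\<omega>. (\<Sum>i\<in>{1..d}. \<bar>\<omega> i - clip_tan (R + real n) (\<omega> (d + i))\<bar>) \<partial>M) \<le> \<epsilon>"
  shows "distr M (Rn d) (\<lambda>\<omega>. restrict \<omega> {1..d}) \<in> mart_ball_on d \<Lambda> \<nu> \<epsilon>"
    and "(\<integral>x. f x \<partial>distr M (Rn d) (\<lambda>\<omega>. restrict \<omega> {1..d})) = (\<integral>\<omega>. f (restrict \<omega> {1..d}) \<partial>M)"
proof -
  interpret M: prob_space M by fact
  let ?K = "compactified d \<Lambda>"
  define X' where "X' \<omega> = restrict \<omega> {1..d}" for \<omega> :: "nat \<Rightarrow> real"
  define X where "X \<omega> = (\<lambda>k\<in>{1..d}. tan (\<omega> (d + k)))" for \<omega> :: "nat \<Rightarrow> real"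
  define \<pi> where "\<pi> = distr M (Rn d) X'"
  have coord: "(\<lambda>\<omega>. \<omega> i) \<in> borel_measurable M" for i
    unfolding measurable_cong_sets[OF M(2) refl]
    by (rule borel_measurable_continuous_onI[OF continuous_coordinate])
  have tan_coord: "(\<lambda>\<omega>. tan (\<omega> i)) \<in> borel_measurable M" for i
    by (rule measurable_compose[OF coord tan_measurable])
  have X'_m: "X' \<in> measurable M (Rn d)"
    unfolding X'_def Rn_def by (rule measurable_restrict) (rule coord)
  have X_m: "X \<in> measurable M (Rn d)"
    unfolding X_def Rn_def by (rule measurable_restrict) (rule tan_coord)
  have sets_\<pi>: "sets \<pi> = sets (Rn d)" by (simp add: \<pi>_def)
  have prob_\<pi>: "prob_space \<pi>" unfolding \<pi>_def by (rule M.prob_space_distr[OF X'_m])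
  interpret P: prob_space \<pi> by fact
  have int_\<pi>: "(\<integral>x. g x \<partial>\<pi>) = (\<integral>\<omega>. g (X' \<omega>) \<partial>M)" if "g \<in> borel_measurable (Rn d)" for g :: "_ \<Rightarrow> real"
    unfolding \<pi>_def by (rule integral_distr[OF X'_m that])
  have m\<pi>: "(\<lambda>x. x i) \<in> borel_measurable \<pi>" if "i \<in> {1..d}" for i
    using coordinate_measurable_Rn[OF that] measurable_cong_sets[OF sets_\<pi> refl] by blast
  have obj: "(\<integral>x. f x \<partial>\<pi>) = (\<integral>\<omega>. f (restrict \<omega> {1..d}) \<partial>M)"
    using int_\<pi>[OF continuous_imp_measurable_Rn[OF f]] by (simp add: X'_def)
  have AE_X': "AE \<omega> in M. X' \<omega> \<in> PiE {1..d} \<Lambda>"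
    using M(3)
  proof eventually_elim
    fix \<omega> assume \<omega>: "\<omega> \<in> ?K"
    have "\<omega> i \<in> \<Lambda> i" if "i \<in> {1..d}" for i
    proof -
      have "i \<in> {1..2 * d}" "i \<le> d" using that by auto
      then show ?thesis using PiE_mem[OF \<omega>[unfolded compactified_def], of i] by simp
    qed
    then show "X' \<omega> \<in> PiE {1..d} \<Lambda>" by (auto simp: X'_def)
  qed
  have \<Lambda>_sets: "PiE {1..d} \<Lambda> \<in> sets (Rn d)"
    unfolding Rn_def by (rule sets_PiM_I_finite) (use \<Lambda> borel_compact in auto)
  have AE_\<pi>: "AE x in \<pi>. x \<in> PiE {1..d} \<Lambda>"
    unfolding \<pi>_def
  proof (subst AE_distr_iff[OF X'_m])
    have "{x \<in> space (Rn d). x \<in> PiE {1..d} \<Lambda>} = PiE {1..d} \<Lambda>" by (auto simp: space_Rn)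
    then show "{x \<in> space (Rn d). x \<in> PiE {1..d} \<Lambda>} \<in> sets (Rn d)" using \<Lambda>_sets by simp
  qed (rule AE_X')
  have mart: "martingale_measure d \<pi>"
  proof (rule martingale_measureI_ramp[OF prob_\<pi> sets_\<pi>])
    show "AE x in \<pi>. \<bar>x i\<bar> \<le> R" if "i \<in> {1..d}" for i
      using AE_\<pi> by eventually_elim (use R(2)[OF that] that in \<open>auto simp: PiE_iff\<close>)
    fix k n and q :: "nat \<Rightarrow> rat" assume k: "k \<in> {1..<d}"
    have ii: "i \<in> {1..d}" if "i \<in> {1..k}" for i using k that by auto
    have kk: "Suc k \<in> {1..d}" "k \<in> {1..d}" using k by auto
    have "(\<lambda>x. (\<Prod>i\<in>{1..k}. ramp (q i) n (x i)) * (x (Suc k) - x k)) \<in> borel_measurable (Rn d)"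
    proof (intro borel_measurable_times borel_measurable_diff coordinate_measurable_Rn kk)
      show "(\<lambda>x. \<Prod>i\<in>{1..k}. ramp (q i) n (x i)) \<in> borel_measurable (Rn d)"
        by (rule borel_measurable_prod) (rule measurable_compose[OF coordinate_measurable_Rn[OF ii] ramp_measurable])
    qed
    from int_\<pi>[OF this] have "(\<integral>x. (\<Prod>i\<in>{1..k}. ramp (q i) n (x i)) * (x (Suc k) - x k) \<partial>\<pi>)
        = (\<integral>\<omega>. (\<Prod>i\<in>{1..k}. ramp (q i) n (X' \<omega> i)) * (X' \<omega> (Suc k) - X' \<omega> k) \<partial>M)" .
    also have "\<dots> = (\<integral>\<omega>. (\<Prod>i\<in>{1..k}. ramp (q i) n (\<omega> i)) * (\<omega> (Suc k) - \<omega> k) \<partial>M)"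
    proof (rule Bochner_Integration.integral_cong[OF refl])
      fix \<omega>
      have X'_eq: "X' \<omega> i = \<omega> i" if "i \<in> {1..d}" for i using that by (simp add: X'_def)
      have "(\<Prod>i\<in>{1..k}. ramp (q i) n (X' \<omega> i)) = (\<Prod>i\<in>{1..k}. ramp (q i) n (\<omega> i))"
        by (rule prod.cong[OF refl]) (simp only: X'_eq[OF ii])
      then show "(\<Prod>i\<in>{1..k}. ramp (q i) n (X' \<omega> i)) * (X' \<omega> (Suc k) - X' \<omega> k)
          = (\<Prod>i\<in>{1..k}. ramp (q i) n (\<omega> i)) * (\<omega> (Suc k) - \<omega> k)"
        by (simp only: X'_eq[OF kk(1)] X'_eq[OF kk(2)])
    qed
    finally show "(\<integral>x. (\<Prod>i\<in>{1..k}. ramp (q i) n (x i)) * (x (Suc k) - x k) \<partial>\<pi>) = 0"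
      using orth[OF k] by simp
  qed
  have int_x: "integrable \<pi> (\<lambda>x. x i)" if "i \<in> {1..d}" for i
    using mart that by (auto simp: martingale_measure_def)
  have mean: "(\<integral>x. x i \<partial>\<pi>) = 0" if "i \<in> {1..d}" for i
    using that
  proof (induction i)
    case (Suc i)
    show ?case
    proof (cases "i = 0")
      case True
      have "(\<integral>x. x 1 \<partial>\<pi>) = (\<integral>\<omega>. X' \<omega> 1 \<partial>M)"
        using int_\<pi>[OF coordinate_measurable_Rn] Suc.prems True by auto
      also have "\<dots> = (\<integral>\<omega>. \<omega> 1 \<partial>M)" using \<open>d \<ge> 1\<close> by (simp add: X'_def)
      finally show ?thesis using center True by simp
    next
      case False
      then have i: "i \<in> {1..<d}" "i \<in> {1..d}" using Suc.prems by auto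
      have "(\<integral>x. x (Suc i) - x i \<partial>\<pi>) = 0"
        using martingale_increment_orthogonal(2)[OF mart i(1), of "\<lambda>_. 1" 1] by simp
      then show ?thesis using Suc.IH[OF i(2)] int_x[OF i(2)] int_x[OF Suc.prems] by simp
    qed
  qed simp
  \<comment> \<open>The ramps identify the law of the compactified coordinate, hence the law of its tangent.\<close>
  have law: "distr M borel (\<lambda>\<omega>. \<omega> (d + k)) = distr (\<nu> k) borel arctan" if k: "k \<in> {1..d}" for k
  proof -
    interpret N: prob_space "\<nu> k" by (rule \<nu>[OF k])
    have am: "arctan \<in> borel_measurable (\<nu> k)"
      unfolding measurable_cong_sets[OF \<nu>(2)[OF k] refl]
      by (intro borel_measurable_continuous_onI continuous_intros)
    show ?thesis
    proof (rule prob_eqI_ramp)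
      show "prob_space (distr M borel (\<lambda>\<omega>. \<omega> (d + k)))" by (rule M.prob_space_distr[OF coord])
      show "prob_space (distr (\<nu> k) borel arctan)" by (rule N.prob_space_distr[OF am])
      show "(\<integral>x. ramp q n x \<partial>distr M borel (\<lambda>\<omega>. \<omega> (d + k))) = (\<integral>x. ramp q n x \<partial>distr (\<nu> k) borel arctan)" for q n
        using marg[OF k] by (simp add: integral_distr[OF coord ramp_measurable] integral_distr[OF am ramp_measurable])
    qed auto
  qed
  have law_tan: "distr M borel (\<lambda>\<omega>. tan (\<omega> (d + k))) = \<nu> k" if k: "k \<in> {1..d}" for k
  proof -
    have am: "arctan \<in> measurable (\<nu> k) borel"
      unfolding measurable_cong_sets[OF \<nu>(2)[OF k] refl]
      by (intro borel_measurable_continuous_onI continuous_intros)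
    have "distr M borel (\<lambda>\<omega>. tan (\<omega> (d + k))) = distr (distr M borel (\<lambda>\<omega>. \<omega> (d + k))) borel tan"
      by (subst distr_distr[OF tan_measurable coord]) (simp add: o_def)
    also have "\<dots> = distr (\<nu> k) borel (\<lambda>x. x)"
      unfolding law[OF k] by (subst distr_distr[OF tan_measurable am]) (simp add: o_def tan_arctan)
    also have "\<dots> = \<nu> k" by (rule distr_id2) (simp add: \<nu>(2)[OF k])
    finally show ?thesis .
  qed
  have AE_open: "AE \<omega> in M. - (pi / 2) < \<omega> (d + k) \<and> \<omega> (d + k) < pi / 2" if k: "k \<in> {1..d}" for k
  proof (rule AE_distrD[OF coord])
    have am: "arctan \<in> measurable (\<nu> k) borel"
      unfolding measurable_cong_sets[OF \<nu>(2)[OF k] refl]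
      by (intro borel_measurable_continuous_onI continuous_intros)
    show "AE u in distr M borel (\<lambda>\<omega>. \<omega> (d + k)). - (pi / 2) < u \<and> u < pi / 2"
      unfolding law[OF k] by (subst AE_distr_iff[OF am]) (use arctan_bounded in auto)
  qed
  define \<pi>' where "\<pi>' = distr M (Rn d) X"
  have \<pi>': "\<pi>' \<in> with_marginals d \<nu>"
  proof -
    have "marginal \<pi>' i = \<nu> i" if i: "i \<in> {1..d}" for i
    proof -
      have "marginal \<pi>' i = distr M borel (\<lambda>\<omega>. X \<omega> i)"
        unfolding marginal_def \<pi>'_def by (subst distr_distr[OF coordinate_measurable_Rn[OF i] X_m]) (simp add: o_def)
      also have "\<dots> = \<nu> i" using law_tan[OF i] i by (simp add: X_def)
      finally show ?thesis .
    qed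
    then show ?thesis
      using M.prob_space_distr[OF X_m] by (auto simp: with_marginals_def prob_Rn_def \<pi>'_def)
  qed
  define \<mu> where "\<mu> = distr M (Rn d \<Otimes>\<^sub>M Rn d) (\<lambda>\<omega>. (X' \<omega>, X \<omega>))"
  have pair_m: "(\<lambda>\<omega>. (X' \<omega>, X \<omega>)) \<in> measurable M (Rn d \<Otimes>\<^sub>M Rn d)"
    by (rule measurable_Pair[OF X'_m X_m])
  have \<mu>: "\<mu> \<in> couplings d \<pi> \<pi>'"
  proof -
    have "distr \<mu> (Rn d) fst = \<pi>" "distr \<mu> (Rn d) snd = \<pi>'"
      unfolding \<mu>_def \<pi>_def \<pi>'_def
      by (subst distr_distr[OF _ pair_m]; simp add: o_def)+
    then show ?thesis using M.prob_space_distr[OF pair_m] by (auto simp: couplings_def \<mu>_def)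
  qed
  define c where "c n \<omega> = (\<Sum>i\<in>{1..d}. \<bar>\<omega> i - clip_tan (R + real n) (\<omega> (d + i))\<bar>)" for n :: nat and \<omega> :: "nat \<Rightarrow> real"
  have c_cont: "continuous_on UNIV (c n)" for n
  proof -
    have "R + real n \<ge> 0" using R by simp
    then show ?thesis unfolding c_def
      by (intro continuous_intros continuous_on_compose2[OF continuous_clip_tan continuous_coordinate]) auto
  qed
  have c_int: "integrable M (c n)" for n
    by (rule continuous_integrable_on_compact[OF M compact_compactified c_cont]) (rule \<Lambda>)
  have c_nn: "c n \<omega> \<ge> 0" for n \<omega> unfolding c_def by (rule sum_nonneg) simp
  have c_le: "(\<integral>\<^sup>+\<omega>. ennreal (c n \<omega>) \<partial>M) \<le> ennreal \<epsilon>" for n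
    using nn_integral_eq_integral[OF c_int AE_I2[OF c_nn]] cost[of n] by (simp add: c_def[abs_def] ennreal_leI)
  have AE_lim: "AE \<omega> in M. ennreal (l1_dist d (X' \<omega>) (X \<omega>)) = liminf (\<lambda>n. ennreal (c n \<omega>))"
  proof -
    have "AE \<omega> in M. \<forall>k\<in>{1..d}. - (pi / 2) < \<omega> (d + k) \<and> \<omega> (d + k) < pi / 2"
      by (rule AE_finite_allI) (use AE_open in auto)
    then show ?thesis
    proof eventually_elim
      fix \<omega> assume \<omega>: "\<forall>k\<in>{1..d}. - (pi / 2) < \<omega> (d + k) \<and> \<omega> (d + k) < pi / 2"
      have "\<forall>\<^sub>F n in sequentially. \<forall>k\<in>{1..d}. clip_tan (R + real n) (\<omega> (d + k)) = tan (\<omega> (d + k))"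
        using \<omega> clip_tan_eventually by (intro eventually_ball_finite) auto
      then have "\<forall>\<^sub>F n in sequentially. ennreal (c n \<omega>) = ennreal (l1_dist d (X' \<omega>) (X \<omega>))"
        unfolding c_def l1_dist_def
        by eventually_elim (rule arg_cong[of _ _ ennreal], rule sum.cong, auto simp: X'_def X_def)
      then have "(\<lambda>n. ennreal (c n \<omega>)) \<longlonglongrightarrow> ennreal (l1_dist d (X' \<omega>) (X \<omega>))"
        by (rule tendsto_eventually)
      then show "ennreal (l1_dist d (X' \<omega>) (X \<omega>)) = liminf (\<lambda>n. ennreal (c n \<omega>))"
        by (intro lim_imp_Liminf[symmetric]) auto
    qed
  qed
  have l1_m: "(\<lambda>p. ennreal (l1_dist d (fst p) (snd p))) \<in> borel_measurable (Rn d \<Otimes>\<^sub>M Rn d)"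
    unfolding l1_dist_def
    by (rule measurable_compose[OF _ measurable_ennreal])
      (intro borel_measurable_sum borel_measurable_abs borel_measurable_diff
        measurable_compose[OF measurable_fst coordinate_measurable_Rn] measurable_compose[OF measurable_snd coordinate_measurable_Rn])
  have "marginal_dist d \<nu> \<pi> \<le> (\<integral>\<^sup>+(x, y). ennreal (l1_dist d x y) \<partial>\<mu>)"
    unfolding marginal_dist_def wasserstein_def by (intro INF_lower2[OF \<pi>'] INF_lower[OF \<mu>])
  also have "\<dots> = (\<integral>\<^sup>+\<omega>. ennreal (l1_dist d (X' \<omega>) (X \<omega>)) \<partial>M)"
    unfolding \<mu>_def case_prod_beta by (subst nn_integral_distr[OF pair_m]) (use l1_m in simp_all)
  also have "\<dots> = (\<integral>\<^sup>+\<omega>. liminf (\<lambda>n. ennreal (c n \<omega>)) \<partial>M)"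
    by (rule nn_integral_cong_AE[OF AE_lim])
  also have "\<dots> \<le> liminf (\<lambda>n. \<integral>\<^sup>+\<omega>. ennreal (c n \<omega>) \<partial>M)"
    by (rule nn_integral_liminf) (rule measurable_compose[OF borel_measurable_integrable[OF c_int] measurable_ennreal])
  also have "\<dots> \<le> limsup (\<lambda>n. \<integral>\<^sup>+\<omega>. ennreal (c n \<omega>) \<partial>M)" by (rule Liminf_le_Limsup) simp
  also have "\<dots> \<le> ennreal \<epsilon>" by (rule Limsup_bounded) (simp add: c_le)
  finally have dist: "marginal_dist d \<nu> \<pi> \<le> ennreal \<epsilon>" .
  have "emeasure \<pi> (PiE {1..d} \<Lambda>) = 1"
    using AE_\<pi> \<Lambda>_sets by (intro P.emeasure_eq_1_AE) (simp_all add: sets_\<pi>)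
  moreover have "(\<integral>x. x \<partial>marginal \<pi> i) = 0" if "i \<in> {1..d}" for i
    unfolding marginal_def using mean[OF that] by (subst integral_distr[OF m\<pi>[OF that]]) auto
  ultimately have "\<pi> \<in> mart_ball_on d \<Lambda> \<nu> \<epsilon>"
    using mart dist \<Lambda>_sets prob_\<pi> sets_\<pi>
    by (auto simp: mart_ball_on_def mart_ball_def centered_martingale_measures_def prob_on_def prob_Rn_def)
  then show "distr M (Rn d) (\<lambda>\<omega>. restrict \<omega> {1..d}) \<in> mart_ball_on d \<Lambda> \<nu> \<epsilon>"
    by (simp add: \<pi>_def X'_def[abs_def])
  show "(\<integral>x. f x \<partial>distr M (Rn d) (\<lambda>\<omega>. restrict \<omega> {1..d})) = (\<integral>\<omega>. f (restrict \<omega> {1..d}) \<partial>M)"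
    using obj by (simp add: \<pi>_def X'_def[abs_def])
qed


section \<open>Strong duality\<close>

text \<open>
  The thresholds \<open>q\<close> of the martingale tests range over extensional functions, which makes the set
  countable; the multiplier \<open>s\<close> provides both signs, hence equalities.
\<close>

definition moment_functions ::
    "nat \<Rightarrow> ((nat \<Rightarrow> real) \<Rightarrow> real) \<Rightarrow> (nat \<Rightarrow> real measure) \<Rightarrow> real \<Rightarrow> real \<Rightarrow> real \<Rightarrow>
     ((nat \<Rightarrow> real) \<Rightarrow> real) set" where
  "moment_functions d f \<nu> \<epsilon> v R =
     {\<lambda>\<omega>. f (restrict \<omega> {1..d}) - v}
     \<union> (\<Union>s\<in>{1, -1}. {\<lambda>\<omega>. s * \<omega> 1})
     \<union> (\<Union>s\<in>{1, -1}. \<Union>n. \<Union>k\<in>{1..<d}. \<Union>q\<in>PiE {1..k} (\<lambda>_. UNIV).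
          {\<lambda>\<omega>. s * ((\<Prod>i\<in>{1..k}. ramp (q i) n (\<omega> i)) * (\<omega> (Suc k) - \<omega> k))})
     \<union> (\<Union>s\<in>{1, -1}. \<Union>n. \<Union>q. \<Union>k\<in>{1..d}.
          {\<lambda>\<omega>. s * (ramp q n (\<omega> (d + k)) - (\<integral>x. ramp q n (arctan x) \<partial>\<nu> k))})
     \<union> (\<Union>n::nat. {\<lambda>\<omega>. \<epsilon> - (\<Sum>i\<in>{1..d}. \<bar>\<omega> i - clip_tan (R + real n) (\<omega> (d + i))\<bar>)})"

lemma countable_moment_functions: "countable (moment_functions d f \<nu> \<epsilon> v R)"
  unfolding moment_functions_def
  by (intro countable_Un countable_UN countable_PiE) auto

lemma continuous_moment_functions:
  assumes f: "continuous_on (PiE {1..d} (\<lambda>_. UNIV)) f" and "R \<ge> 0" "h \<in> moment_functions d f \<nu> \<epsilon> v R"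
  shows "continuous_on UNIV h"
proof -
  have 1: "continuous_on UNIV (\<lambda>\<omega>. f (restrict \<omega> {1..d}) - v)"
    by (intro continuous_intros continuous_on_compose2[OF f continuous_restrict_coordinates]) auto
  have 2: "continuous_on UNIV (\<lambda>\<omega> :: nat \<Rightarrow> real. s * \<omega> 1)" for s by (intro continuous_intros continuous_coordinate)
  have 3: "continuous_on UNIV (\<lambda>\<omega>. s * ((\<Prod>i\<in>{1..k}. ramp (q i) n (\<omega> i)) * (\<omega> (Suc k) - \<omega> k)))" for s n k q
    by (intro continuous_intros continuous_coordinate continuous_on_compose2[OF continuous_ramp continuous_coordinate]) auto
  have 4: "continuous_on UNIV (\<lambda>\<omega>. s * (ramp q n (\<omega> (d + k)) - c))" for s n k q c
    by (intro continuous_intros continuous_on_compose2[OF continuous_ramp continuous_coordinate]) auto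
  have 5: "continuous_on UNIV (\<lambda>\<omega>. \<epsilon> - (\<Sum>i\<in>{1..d}. \<bar>\<omega> i - clip_tan (R + real n) (\<omega> (d + i))\<bar>))" for n
  proof -
    have "R + real n \<ge> 0" using \<open>R \<ge> 0\<close> by simp
    then show ?thesis
      by (intro continuous_intros continuous_coordinate continuous_on_compose2[OF continuous_clip_tan continuous_coordinate]) auto
  qed
  show ?thesis
    using assms(3) unfolding moment_functions_def Un_iff UN_iff singleton_iff
    by (elim disjE bexE) (simp_all only: 1 2 3 4 5)
qed

lemma moment_functions_dominating:
  assumes "d \<ge> 1" "R \<ge> 0" and R: "\<And>i x. i \<in> {1..d} \<Longrightarrow> x \<in> \<Lambda> i \<Longrightarrow> \<bar>x\<bar> \<le> R"
  shows "moment_functions d f \<nu> \<epsilon> v R \<subseteq> dominating d f \<Lambda> \<nu> \<epsilon> v"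
proof
  fix h assume h: "h \<in> moment_functions d f \<nu> \<epsilon> v R"
  have 5: "(\<lambda>\<omega>. \<epsilon> - (\<Sum>i\<in>{1..d}. \<bar>\<omega> i - clip_tan (R + real n) (\<omega> (d + i))\<bar>)) \<in> dominating d f \<Lambda> \<nu> \<epsilon> v" for n
    using \<open>R \<ge> 0\<close> by (intro cost_dominating) (auto intro: order_trans[OF R])
  show "h \<in> dominating d f \<Lambda> \<nu> \<epsilon> v"
    using h unfolding moment_functions_def Un_iff UN_iff singleton_iff
    by (elim disjE bexE)
      (simp_all only: 5 objective_dominating centering_dominating[OF \<open>d \<ge> 1\<close>] martingale_dominating marginal_dominating)
qed

text \<open>
  The dual value is approached but need not be attained, whereas here a primal measure reaches it exactly:
  the target \<open>v\<close> itself is one of the moment conditions, and these survive weak limits.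
\<close>

lemma dual_attained_by_primal:
  assumes "d \<ge> 1" and f: "continuous_on (PiE {1..d} (\<lambda>_. UNIV)) f"
    and \<Lambda>: "\<And>i. i \<in> {1..d} \<Longrightarrow> compact (\<Lambda> i)"
    and \<nu>: "\<And>i. i \<in> {1..d} \<Longrightarrow> prob_space (\<nu> i)" "\<And>i. i \<in> {1..d} \<Longrightarrow> sets (\<nu> i) = sets borel"
    and "\<epsilon> \<ge> 0" and ball: "mart_ball_on d \<Lambda> \<nu> \<epsilon> \<noteq> {}"
    and v: "ereal v \<le> dual_value d f \<Lambda> \<nu> \<epsilon>"
  shows "\<exists>\<pi>\<in>mart_ball_on d \<Lambda> \<nu> \<epsilon>. v \<le> (\<integral>x. f x \<partial>\<pi>)"
proof -
  obtain R where R: "R \<ge> 0" "\<And>i x. i \<in> {1..d} \<Longrightarrow> x \<in> \<Lambda> i \<Longrightarrow> \<bar>x\<bar> \<le> R"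
  proof -
    have "compact (\<Union>i\<in>{1..d}. \<Lambda> i)" by (intro compact_UN \<Lambda>) auto
    then obtain R where "R > 0" "\<forall>x\<in>(\<Union>i\<in>{1..d}. \<Lambda> i). norm x \<le> R"
      using compact_imp_bounded bounded_pos by metis
    then show ?thesis by (intro that[of R]) auto
  qed
  let ?H = "moment_functions d f \<nu> \<epsilon> v R"
  have "\<exists>M. prob_space M \<and> sets M = sets borel \<and> (AE \<omega> in M. \<omega> \<in> compactified d \<Lambda>) \<and> (\<forall>h\<in>?H. (\<integral>\<omega>. h \<omega> \<partial>M) \<ge> 0)"
  proof (rule countable_moment_alternative)
    show "compact (compactified d \<Lambda>)" by (rule compact_compactified) (rule \<Lambda>)
    show "countable ?H" by (rule countable_moment_functions)
    show "?H \<noteq> {}" by (auto simp: moment_functions_def)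
    show "continuous_on UNIV h" if "h \<in> ?H" for h by (rule continuous_moment_functions[OF f R(1) that])
    fix F and c :: "((nat \<Rightarrow> real) \<Rightarrow> real) \<Rightarrow> real" and \<delta> :: real
    assume F: "finite F" "F \<subseteq> ?H" and c: "\<And>h. c h \<ge> 0" and "\<delta> > 0"
    have sub: "F \<subseteq> dominating d f \<Lambda> \<nu> \<epsilon> v"
      using F(2) moment_functions_dominating[OF \<open>d \<ge> 1\<close> R] by (rule order_trans)
    show "\<exists>\<omega>\<in>compactified d \<Lambda>. (\<Sum>h\<in>F. c h * h \<omega>) > - \<delta>"
      by (rule dominating_not_negative[OF \<open>d \<ge> 1\<close> \<Lambda> \<nu> \<open>\<epsilon> \<ge> 0\<close> ball v sum_dominating[OF \<nu> F(1) sub c] \<open>\<delta> > 0\<close>])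
  next
    fix M :: "(nat \<Rightarrow> real) measure"
    assume "prob_space M" "sets M = sets borel" "AE \<omega> in M. \<omega> \<in> compactified d \<Lambda>"
      and "\<And>h. h \<in> ?H \<Longrightarrow> (\<integral>\<omega>. h \<omega> \<partial>M) \<ge> 0"
    then show "\<exists>M. prob_space M \<and> sets M = sets borel \<and> (AE \<omega> in M. \<omega> \<in> compactified d \<Lambda>) \<and> (\<forall>h\<in>?H. (\<integral>\<omega>. h \<omega> \<partial>M) \<ge> 0)"
      by (intro exI[of _ M] conjI ballI)
  qed
  then obtain M where M: "prob_space M" "sets M = sets borel" "AE \<omega> in M. \<omega> \<in> compactified d \<Lambda>"
    and mom': "\<forall>h\<in>?H. (\<integral>\<omega>. h \<omega> \<partial>M) \<ge> 0" by (elim exE conjE) (rule that)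
  note mom = bspec[OF mom']
  interpret prob_space M by fact
  have H_int: "integrable M h" if "continuous_on UNIV h" for h :: "_ \<Rightarrow> real"
    by (rule continuous_integrable_on_compact[OF M compact_compactified that]) (rule \<Lambda>)
  have zero: "(\<integral>\<omega>. g \<omega> \<partial>M) = 0" if "(\<lambda>\<omega>. 1 * g \<omega>) \<in> ?H" "(\<lambda>\<omega>. - 1 * g \<omega>) \<in> ?H" for g
    using mom[OF that(1)] mom[OF that(2)] by simp
  have mem1: "(\<lambda>\<omega>. f (restrict \<omega> {1..d}) - v) \<in> ?H" unfolding moment_functions_def
    by (rule UnI1, rule UnI1, rule UnI1, rule UnI1, rule singletonI)
  have mem2: "(\<lambda>\<omega>. s * \<omega> 1) \<in> ?H" if "s \<in> {1, -1}" for s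
    unfolding moment_functions_def
    by (rule UnI1, rule UnI1, rule UnI1, rule UnI2, rule UN_I[OF that], rule singletonI)
  have mem3: "(\<lambda>\<omega>. s * ((\<Prod>i\<in>{1..k}. ramp (q i) n (\<omega> i)) * (\<omega> (Suc k) - \<omega> k))) \<in> ?H"
    if "s \<in> {1, -1}" "k \<in> {1..<d}" "q \<in> PiE {1..k} (\<lambda>_. UNIV)" for s k n and q :: "nat \<Rightarrow> rat"
    unfolding moment_functions_def
    by (rule UnI1, rule UnI1, rule UnI2, rule UN_I[OF that(1)], rule UN_I[OF UNIV_I], rule UN_I[OF that(2)],
        rule UN_I[OF that(3)], rule singletonI)
  have mem4: "(\<lambda>\<omega>. s * (ramp q n (\<omega> (d + k)) - (\<integral>x. ramp q n (arctan x) \<partial>\<nu> k))) \<in> ?H"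
    if "s \<in> {1, -1}" "k \<in> {1..d}" for s k n q
    unfolding moment_functions_def
    by (rule UnI1, rule UnI2, rule UN_I[OF that(1)], rule UN_I[OF UNIV_I], rule UN_I[OF UNIV_I],
        rule UN_I[OF that(2)], rule singletonI)
  have mem5: "(\<lambda>\<omega>. \<epsilon> - (\<Sum>i\<in>{1..d}. \<bar>\<omega> i - clip_tan (R + real n) (\<omega> (d + i))\<bar>)) \<in> ?H" for n
    unfolding moment_functions_def by (rule UnI2, rule UN_I[OF UNIV_I], rule singletonI)
  let ?\<pi> = "distr M (Rn d) (\<lambda>\<omega>. restrict \<omega> {1..d})"
  have center: "(\<integral>\<omega>. \<omega> 1 \<partial>M) = 0" by (rule zero) (rule mem2, simp)+
  have orth: "(\<integral>\<omega>. (\<Prod>i\<in>{1..k}. ramp (q i) n (\<omega> i)) * (\<omega> (Suc k) - \<omega> k) \<partial>M) = 0"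
    if k: "k \<in> {1..<d}" for k n and q :: "nat \<Rightarrow> rat"
  proof -
    \<comment> \<open>Only the thresholds with index in \<open>{1..k}\<close> enter.\<close>
    have "(\<integral>\<omega>. (\<Prod>i\<in>{1..k}. ramp (restrict q {1..k} i) n (\<omega> i)) * (\<omega> (Suc k) - \<omega> k) \<partial>M) = 0"
      by (rule zero; rule mem3) (use k in auto)
    moreover have "(\<Prod>i\<in>{1..k}. ramp (restrict q {1..k} i) n (\<omega> i)) = (\<Prod>i\<in>{1..k}. ramp (q i) n (\<omega> i))" for \<omega> :: "nat \<Rightarrow> real"
      by (rule prod.cong) auto
    ultimately show ?thesis by simp
  qed
  have marg: "(\<integral>\<omega>. ramp q n (\<omega> (d + k)) \<partial>M) = (\<integral>x. ramp q n (arctan x) \<partial>\<nu> k)" if k: "k \<in> {1..d}" for k n q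
  proof -
    have "(\<integral>\<omega>. ramp q n (\<omega> (d + k)) - (\<integral>x. ramp q n (arctan x) \<partial>\<nu> k) \<partial>M) = 0"
      by (rule zero; rule mem4) (use k in auto)
    moreover have "integrable M (\<lambda>\<omega>. ramp q n (\<omega> (d + k)))"
      by (intro H_int continuous_on_compose2[OF continuous_ramp continuous_coordinate]) auto
    ultimately show ?thesis by (simp add: prob_space)
  qed
  have cost: "(\<integral>\<omega>. (\<Sum>i\<in>{1..d}. \<bar>\<omega> i - clip_tan (R + real n) (\<omega> (d + i))\<bar>) \<partial>M) \<le> \<epsilon>" for n
  proof -
    let ?c = "\<lambda>\<omega>. \<Sum>i\<in>{1..d}. \<bar>\<omega> i - clip_tan (R + real n) (\<omega> (d + i))\<bar>"
    have "integrable M (\<lambda>\<omega>. \<epsilon> - (\<epsilon> - ?c \<omega>))"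
      by (rule Bochner_Integration.integrable_diff[OF integrable_const H_int[OF continuous_moment_functions[OF f R(1) mem5]]])
    then have "integrable M ?c" by (simp only: diff_diff_eq2 add_diff_cancel_left')
    then show ?thesis using mom[OF mem5[of n]] by (simp add: prob_space)
  qed
  have "?\<pi> \<in> mart_ball_on d \<Lambda> \<nu> \<epsilon>"
    by (rule primal_measure_of_moments(1)[OF \<open>d \<ge> 1\<close> f \<Lambda> R \<nu> M center orth marg cost])
  moreover have "v \<le> (\<integral>x. f x \<partial>?\<pi>)"
  proof -
    have "(\<integral>x. f x \<partial>?\<pi>) = (\<integral>\<omega>. f (restrict \<omega> {1..d}) \<partial>M)"
      by (rule primal_measure_of_moments(2)[OF \<open>d \<ge> 1\<close> f \<Lambda> R \<nu> M center orth marg cost])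
    moreover have "integrable M (\<lambda>\<omega>. f (restrict \<omega> {1..d}))"
      by (intro H_int continuous_on_compose2[OF f continuous_restrict_coordinates]) auto
    ultimately show ?thesis using mom[OF mem1] by (simp add: prob_space)
  qed
  ultimately show ?thesis by blast
qed

theorem theorem5:
  fixes d :: nat and f :: "(nat \<Rightarrow> real) \<Rightarrow> real" and \<Lambda> :: "nat \<Rightarrow> real set"
    and \<nu> :: "nat \<Rightarrow> real measure" and \<theta> \<epsilon> :: real
  assumes "d \<ge> 1"
    and "continuous_on (PiE {1..d} (\<lambda>_. UNIV)) f"
    and "\<And>i. i \<in> {1..d} \<Longrightarrow> compact (\<Lambda> i)"
    and "\<And>i. i \<in> {1..d} \<Longrightarrow> prob_space (\<nu> i) \<and> sets (\<nu> i) = sets borel"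
    and "\<theta> > 0"
    and "(SUP i\<in>{1..d}. \<integral>\<^sup>+x. ennreal (exp (\<theta> * x\<^sup>2)) \<partial>\<nu> i) < \<infinity>"
    and "\<And>i. i \<in> {1..d} \<Longrightarrow> (\<integral>x. x \<partial>\<nu> i) = 0"
    and "\<epsilon> > 0"
    and "mart_ball_on d \<Lambda> \<nu> \<epsilon> \<noteq> {}"
  shows "primal_value d f \<Lambda> \<nu> \<epsilon> = dual_value d f \<Lambda> \<nu> \<epsilon> \<and>
         (\<exists>\<pi>\<in>mart_ball_on d \<Lambda> \<nu> \<epsilon>. ereal (\<integral>x. f x \<partial>\<pi>) = primal_value d f \<Lambda> \<nu> \<epsilon>)"
proof -
  let ?I = "primal_value d f \<Lambda> \<nu> \<epsilon>" and ?J = "dual_value d f \<Lambda> \<nu> \<epsilon>"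
  note f = assms(2) and \<Lambda> = assms(3)
  have \<nu>: "\<And>i. i \<in> {1..d} \<Longrightarrow> prob_space (\<nu> i)" "\<And>i. i \<in> {1..d} \<Longrightarrow> sets (\<nu> i) = sets borel"
    using assms(4) by auto
  have \<epsilon>: "\<epsilon> \<ge> 0" using assms(8) by simp
  have weak: "ereal (\<integral>x. f x \<partial>\<pi>) \<le> ?J" if "\<pi> \<in> mart_ball_on d \<Lambda> \<nu> \<epsilon>" for \<pi>
    unfolding dual_value_def
  proof (rule INF_greatest)
    fix p assume "p \<in> dual_feasible d f \<Lambda>"
    moreover obtain \<gamma> \<eta> \<alpha> \<beta> where "p = (\<gamma>, \<eta>, \<alpha>, \<beta>)" by (cases p)
    ultimately show "ereal (\<integral>x. f x \<partial>\<pi>)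
        \<le> (case p of (\<gamma>, \<eta>, \<alpha>, \<beta>) \<Rightarrow> ereal (\<gamma> * \<epsilon> + (\<Sum>k\<in>{1..d}. \<integral>x. \<beta> k x \<partial>\<nu> k)))"
      using weak_duality[OF assms(1) f \<Lambda> \<nu> \<epsilon> that, of \<gamma> \<eta> \<alpha> \<beta>] by simp
  qed
  then have IJ: "?I \<le> ?J" unfolding primal_value_def by (rule SUP_least)
  obtain \<pi>0 where \<pi>0: "\<pi>0 \<in> mart_ball_on d \<Lambda> \<nu> \<epsilon>" using assms(9) by blast
  have "?J \<noteq> \<infinity>"
  proof -
    have comp: "compact (PiE {1..d} \<Lambda>)" by (rule compact_PiE) (rule \<Lambda>)
    have cont: "continuous_on (PiE {1..d} \<Lambda>) f" by (rule continuous_on_subset[OF f]) (rule PiE_mono, simp)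
    obtain B where B: "B \<ge> 0" "\<And>x. x \<in> PiE {1..d} \<Lambda> \<Longrightarrow> \<bar>f x\<bar> \<le> B"
      using continuous_on_compact_bounded[OF comp cont] by metis
    \<comment> \<open>Constants bounding \<open>f\<close> on \<open>\<Lambda>\<close> show that the dual problem is feasible.\<close>
    have "(0, 0, \<lambda>_ _. 0, \<lambda>_ _. B) \<in> dual_feasible d f \<Lambda>"
      unfolding dual_feasible_iff
    proof (intro conjI ballI)
      show "(0, 0, \<lambda>_ _. 0, \<lambda>_ _. B) \<in> multipliers d \<Lambda>" by (auto simp: multipliers_def)
      fix x x' assume "x' \<in> PiE {1..d} \<Lambda>"
      then have "f x' \<le> 1 * B" using B(2) by (simp add: abs_le_iff)
      also have "\<dots> \<le> real d * B" using assms(1) B(1) by (intro mult_right_mono) auto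
      finally show "lagrangian d f 0 0 (\<lambda>_ _. 0) (\<lambda>_ _. B) x x' \<le> 0" by (simp add: lagrangian_def)
    qed
    from dual_value_le[OF this, of \<nu> \<epsilon>] show ?thesis by auto
  qed
  moreover have "?J \<noteq> - \<infinity>" using weak[OF \<pi>0] by auto
  ultimately obtain v where v: "?J = ereal v" by (cases ?J) auto
  obtain \<pi> where \<pi>: "\<pi> \<in> mart_ball_on d \<Lambda> \<nu> \<epsilon>" "v \<le> (\<integral>x. f x \<partial>\<pi>)"
    using dual_attained_by_primal[OF assms(1) f \<Lambda> \<nu> \<epsilon> assms(9), of v] v by auto
  have "ereal (\<integral>x. f x \<partial>\<pi>) \<le> ?I" unfolding primal_value_def by (rule SUP_upper[OF \<pi>(1)])
  moreover have "?J \<le> ereal (\<integral>x. f x \<partial>\<pi>)" using \<pi>(2) v by simp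
  ultimately have "?I = ?J" "ereal (\<integral>x. f x \<partial>\<pi>) = ?I" using IJ by (auto intro: antisym order_trans)
  then show ?thesis using \<pi>(1) by blast
qed

end
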